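(* Let $\theta\in\{1,\epsilon\}$, $\beta\in k^\times$, $X^*=\beta\cdot\sqrt\theta\in\mathfrak t_\theta^*$ (so $X^*$ is split or unramified), and let $s,\theta'\in k^\times$, $Y=s\cdot\sqrt{\theta'}\in\mathfrak t_{\theta'}$. If $\operatorname{depth}(X^* )+\operatorname{depth}(Y)\le0$, then $M^G_{X^*}(Y)=0$ unless $X^*$ and $Y$ lie in $G$-conjugate tori.
   Context: $k$ is a non-discrete non-Archimedean local field of residual characteristic $\ne 2$, with ring of integers $\mathcal O$, maximal ideal $\mathfrak p$, valuation $\operatorname{ord}$ with value group $\mathbb Z$, residue field of order $q$, $|x|=q^{-\operatorname{ord}(x)}$. $\epsilon\in\mathcal O^\times$ is a lift of a non-square of the residue field. $dx$ (or $dt$) is the Haar measure on $k$ giving $\mathcal O$ measure $1$, and $d^\times x=|x|^{-1}dx$. $\Phi$ is a non-trivial additive character of $k$. For $\theta\in k^\times$, $k_\theta=k\oplus k\sqrt\theta$ is the $k$-algebra $k[x]/(x^2-\theta)$ and $N_\theta(a+b\sqrt\theta)=a^2-b^2\theta$. $G=\mathrm{SL}_2(k)$, $\mathfrak g=\mathfrak{sl}_2(k)$. $\mathbf T_\theta=\{\begin{pmatrix}a&b\\ b\theta&a\end{pmatrix}:a^2-b^2\theta=1\}$, with Lie algebra $\mathfrak t_\theta=k\cdot\sqrt\theta$, where here $\sqrt\theta$ denotes the matrix $\begin{pmatrix}0&1\\ \theta&0\end{pmatrix}$. $X^*=\beta\sqrt\theta$ means the functional $Z\mapsto\mathrm{Tr}(\beta\sqrt\theta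 Z)$ on $\mathfrak g$. $X^*$ lies in $\mathbf T_\theta$ (its centraliser) and $Y$ lies in $\mathbf T_{\theta'}$; $X^*$ is split if $\theta=1$ and unramified if $\theta=\epsilon$. Depth: $\operatorname{depth}(c\sqrt\theta)=\tfrac12\operatorname{ord}(c^2\theta)$ for $c\sqrt\theta\in\mathfrak t_\theta$; $\operatorname{depth}(X^* )$ is the largest real $\rho$ such that $\Phi(\langle X^*,Z\rangle)=1$ for all $Z\in\mathfrak t_\theta$ with $\operatorname{depth}(Z)>-\rho$. Mock Fourier transform: $$M^G_{X^*}(Y)=\sum_{n\in\mathbb Z}\int_{\operatorname{ord}(x)=n}\mathbf 1_{N_\theta(k_\theta^\times)}(x)\Bigl(\sum_{l\in\mathbb Z}\int_{\operatorname{ord}(t)=l}\Phi\bigl(\beta s(x\theta'+x^{-1}\theta-x^{-1}t^2)\bigr)\,dt\Bigr)d^\times x,$$ where $\mathbf 1_S$ is the characteristic function of $S$. *)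

theory Defs
  imports "HOL-Analysis.Analysis"
begin

section \<open>Local fields\<close>

text \<open>The value of \<open>ord\<close> at \<open>0\<close> is unspecified: every use is guarded by \<open>x \<noteq> 0\<close>.\<close>

class discretely_valued_field = field +
  fixes ord :: "'a \<Rightarrow> int"
  assumes ord_mult: "x \<noteq> 0 \<Longrightarrow> y \<noteq> 0 \<Longrightarrow> ord (x * y) = ord x + ord y"
    and ord_add: "x \<noteq> 0 \<Longrightarrow> y \<noteq> 0 \<Longrightarrow> x + y \<noteq> 0 \<Longrightarrow> min (ord x) (ord y) \<le> ord (x + y)"
    and ord_surj: "\<exists>x. x \<noteq> 0 \<and> ord x = n"
begin

definition integer_ring :: "'a set" where
  "integer_ring = {x. x = 0 \<or> ord x \<ge> 0}"

definition max_ideal :: "'a set" where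
  "max_ideal = {x. x = 0 \<or> ord x \<ge> 1}"

definition residue_classes :: "'a set set" where
  "residue_classes = (\<lambda>a. {x. x - a \<in> max_ideal}) ` integer_ring"

definition norm_val :: "'a \<Rightarrow> real" where
  "norm_val x = (if x = 0 then 0 else real (card residue_classes) powi (- ord x))"

end

text \<open>
  The metric, hence the topology and the Borel sets, is the one of the normalized
  absolute value; completeness is part of the class \<open>complete_space\<close>.
\<close>

class nonarch_local_field = discretely_valued_field + complete_space +
  assumes finite_residue_classes: "finite residue_classes"
    and dist_norm_val: "dist x y = norm_val (x - y)"

definition ord_sphere :: "int \<Rightarrow> 'k::discretely_valued_field set" where
  "ord_sphere n = {x. x \<noteq> 0 \<and> ord x = n}"

definition nonsquare_unit :: "'k::discretely_valued_field \<Rightarrow> bool" where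
  "nonsquare_unit e \<longleftrightarrow> e \<noteq> 0 \<and> ord e = 0 \<and> (\<forall>y \<in> integer_ring. e - y\<^sup>2 \<notin> max_ideal)"

definition nontrivial_additive_character :: "('k::nonarch_local_field \<Rightarrow> complex) \<Rightarrow> bool" where
  "nontrivial_additive_character \<Phi> \<longleftrightarrow>
     continuous_on UNIV \<Phi> \<and> (\<forall>x. cmod (\<Phi> x) = 1) \<and>
     (\<forall>x y. \<Phi> (x + y) = \<Phi> x * \<Phi> y) \<and> (\<exists>x. \<Phi> x \<noteq> 1)"

text \<open>These conditions determine the measure uniquely.\<close>

definition normalized_haar :: "'k::nonarch_local_field measure \<Rightarrow> bool" where
  "normalized_haar \<mu> \<longleftrightarrow>
     sets \<mu> = sets borel \<and> (\<forall>a. distr \<mu> borel (\<lambda>x. a + x) = \<mu>) \<and>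
     emeasure \<mu> integer_ring = 1"

definition mult_haar :: "'k::nonarch_local_field measure \<Rightarrow> 'k measure" where
  "mult_haar \<mu> = density \<mu> (\<lambda>x. ennreal (inverse (norm_val x)))"

section \<open>The algebras \<open>k\<^sub>\<theta>\<close> and their norms\<close>

text \<open>The pair \<open>(a, b)\<close> stands for \<open>a + b \<surd>\<theta>\<close>.\<close>

definition quad_mult :: "'k::field \<Rightarrow> 'k \<times> 'k \<Rightarrow> 'k \<times> 'k \<Rightarrow> 'k \<times> 'k" where
  "quad_mult \<theta> u v = (fst u * fst v + \<theta> * snd u * snd v, fst u * snd v + snd u * fst v)"

definition quad_units :: "'k::field \<Rightarrow> ('k \<times> 'k) set" where
  "quad_units \<theta> = {u. \<exists>v. quad_mult \<theta> u v = (1, 0)}"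

definition quad_norm :: "'k::field \<Rightarrow> 'k \<times> 'k \<Rightarrow> 'k" where
  "quad_norm \<theta> u = (fst u)\<^sup>2 - (snd u)\<^sup>2 * \<theta>"

section \<open>\<open>SL\<^sub>2\<close>, its tori and depth\<close>

definition mat2 :: "'k \<Rightarrow> 'k \<Rightarrow> 'k \<Rightarrow> 'k \<Rightarrow> 'k::zero ^ 2 ^ 2" where
  "mat2 a b c d = vector [vector [a, b], vector [c, d]]"

definition SL2 :: "('k::field ^ 2 ^ 2) set" where
  "SL2 = {g. det g = 1}"

definition torus :: "'k::field \<Rightarrow> ('k ^ 2 ^ 2) set" where
  "torus \<theta> = {mat2 a b (b * \<theta>) a | a b. a\<^sup>2 - b\<^sup>2 * \<theta> = 1}"

definition SL2_conjugate :: "('k::field ^ 2 ^ 2) set \<Rightarrow> ('k ^ 2 ^ 2) set \<Rightarrow> bool" where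
  "SL2_conjugate S T \<longleftrightarrow> (\<exists>g \<in> SL2. (\<lambda>t. g ** t ** matrix_inv g) ` S = T)"

text \<open>The element \<open>c \<cdot> \<surd>\<theta>\<close> of the Lie algebra of \<open>torus \<theta>\<close>.\<close>

definition lie_elt :: "'k::field \<Rightarrow> 'k \<Rightarrow> 'k ^ 2 ^ 2" where
  "lie_elt \<theta> c = mat2 0 c (c * \<theta>) 0"

text \<open>The functional on \<open>sl\<^sub>2\<close> denoted \<open>\<beta> \<cdot> \<surd>\<theta>\<close>.\<close>

definition lie_functional :: "'k::field \<Rightarrow> 'k \<Rightarrow> 'k ^ 2 ^ 2 \<Rightarrow> 'k" where
  "lie_functional \<theta> \<beta> = (\<lambda>Z. trace (lie_elt \<theta> \<beta> ** Z))"

text \<open>The depth of \<open>c \<cdot> \<surd>\<theta>\<close>, for \<open>\<theta> \<noteq> 0\<close>.\<close>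

definition lie_depth :: "'k::discretely_valued_field \<Rightarrow> 'k \<Rightarrow> ereal" where
  "lie_depth \<theta> c = (if c = 0 then \<infinity> else ereal (real_of_int (ord (c\<^sup>2 * \<theta>)) / 2))"

text \<open>The maximum exists whenever \<open>\<Phi>\<close> is non-trivial and \<open>X\<close> does not vanish on the
  Lie algebra of \<open>torus \<theta>\<close>.\<close>

definition dual_depth ::
    "('k::discretely_valued_field \<Rightarrow> complex) \<Rightarrow> 'k \<Rightarrow> ('k ^ 2 ^ 2 \<Rightarrow> 'k) \<Rightarrow> real" where
  "dual_depth \<Phi> \<theta> X =
     (GREATEST \<rho>::real. \<forall>c. lie_depth \<theta> c > ereal (- \<rho>) \<longrightarrow> \<Phi> (X (lie_elt \<theta> c)) = 1)"

section \<open>The mock Fourier transform\<close>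

text \<open>
  The value at \<open>Y = s \<cdot> \<surd>\<theta>'\<close> of the transform attached to \<open>\<beta> \<cdot> \<surd>\<theta>\<close>. For non-zero
  parameters, residual characteristic other than 2 and a non-trivial character both sums
  converge absolutely: the summand of the inner one is bounded by the measure of the
  sphere and is zero for \<open>l\<close> sufficiently negative, and the summand of the outer one is
  zero for \<open>\<bar>n\<bar>\<close> large. So \<open>infsum\<close> does not fall back to its default value.
\<close>

definition mock_fourier ::
    "'k::nonarch_local_field measure \<Rightarrow> ('k \<Rightarrow> complex) \<Rightarrow> 'k \<Rightarrow> 'k \<Rightarrow> 'k \<Rightarrow> 'k \<Rightarrow> complex" where
  "mock_fourier \<mu> \<Phi> \<theta> \<beta> \<theta>' s =
     (\<Sum>\<^sub>\<infinity>n\<in>(UNIV::int set). LINT x:ord_sphere n|mult_haar \<mu>.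
        indicator (quad_norm \<theta> ` quad_units \<theta>) x *
        (\<Sum>\<^sub>\<infinity>l\<in>(UNIV::int set). LINT t:ord_sphere l|\<mu>.
           \<Phi> (\<beta> * s * (x * \<theta>' + inverse x * \<theta> - inverse x * t\<^sup>2))))"

end

(*
  Write d for the conductor exponent of y |-> Phi (beta s y); the depth condition says
  ord theta' <= 2 d. The integral over every shell ord x = n vanishes separately. The inner
  sum is a phase Phi (beta s (x theta' + theta / x)) times a Gauss integral that depends only
  on x modulo 1 + p. If the derivative x theta' - theta / x has constant order a < d on the
  shell, replacing x by x (1 + u) with a suitable u in p, chosen on each coset of 1 + p,
  multiplies the integrand by a fixed number other than 1. Otherwise 2 n = - ord theta' and
  theta / theta' is a square w^2, or theta / theta' is not a square and n = - d. In the first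
  case, as the tori are not conjugate, w is not a norm from k_theta, hence neither is any x
  with ord x = n. In the second case one has a Salie sum, and x |-> theta / (theta' x) changes
  the sign of the integrand. The substitutions are isometries of the shell, and a Haar measure
  is invariant under isometries since it gives equal mass to balls of equal radius.
*)
theory Submission
  imports Defs
begin

section \<open>Valuations\<close>

text \<open>A critical point of the phase is a square root of \<theta> / \<theta>', and since 2 is a
  unit, any x whose square approximates \<theta> / \<theta>' to relative order 1 can be refined to
  an exact root. Hence, if \<theta> / \<theta>' is not a square, the derivative has order exactly -n
  on the shell 2 n = - ord \<theta>'. On every other shell its order is the smaller of n + ord
  \<theta>' and -n, two distinct integers with sum ord \<theta>'. The bound ord \<theta>' \<le> 2 d
  therefore leaves a derivative of order d only at 2 n = - ord \<theta>', n = -d; for larger ord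
  \<theta>' the character would no longer detect the variation of the phase near the critical shell,
  and the argument would break down. That \<theta> is 1 or \<epsilon> makes the norm condition
  depend on ord x alone, so the indicator is constant on a shell and survives every substitution. No
  Gauss integral is computed in closed form. Invariance under squares suffices away from n = -d;
  exactly at n = -d the character in the Gauss integral has conductor exponent 0, so that the
  integral reduces to a sum over the residue field and its sign change under a non-square can be
  read off.\<close>

definition ideal_pow :: "int \<Rightarrow> 'a::discretely_valued_field set" where
  "ideal_pow n = {x. x = 0 \<or> n \<le> ord x}"

lemma integer_ring_eq: "integer_ring = ideal_pow 0"
  and max_ideal_eq: "max_ideal = ideal_pow 1"
  by (auto simp: integer_ring_def max_ideal_def ideal_pow_def)

lemma ord_one [simp]: "ord 1 = 0"
  using ord_mult[of 1 1] by simp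

lemma ord_minus [simp]: "ord (- x) = ord (x::'a::discretely_valued_field)"
proof (cases "x = 0")
  case False
  have "ord ((- 1 :: 'a) * (- 1)) = ord (- 1 :: 'a) + ord (- 1 :: 'a)"
    by (rule ord_mult) auto
  then have "ord (- 1 :: 'a) = 0" by simp
  then show ?thesis using ord_mult[of "- 1" x] False by simp
qed simp

lemma ord_diff_commute: "ord (x - y) = ord (y - x)"
  using ord_minus[of "x - y"] by simp

lemma ord_power2: "x \<noteq> 0 \<Longrightarrow> ord (x\<^sup>2) = 2 * ord x"
  by (simp add: power2_eq_square ord_mult)

lemma ord_inverse: "x \<noteq> 0 \<Longrightarrow> ord (inverse x) = - ord x"
  using ord_mult[of x "inverse x"] by simp

lemma ord_divide: "x \<noteq> 0 \<Longrightarrow> y \<noteq> 0 \<Longrightarrow> ord (x / y) = ord x - ord y"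
  by (simp add: divide_inverse ord_mult ord_inverse)

lemma zero_in_ideal_pow [simp]: "0 \<in> ideal_pow n"
  by (simp add: ideal_pow_def)

lemma ideal_pow_add: "x \<in> ideal_pow n \<Longrightarrow> y \<in> ideal_pow n \<Longrightarrow> x + y \<in> ideal_pow n"
  using ord_add[of x y] by (cases "x = 0 \<or> y = 0 \<or> x + y = 0") (auto simp: ideal_pow_def)

lemma ideal_pow_minus_iff [simp]: "- x \<in> ideal_pow n \<longleftrightarrow> x \<in> ideal_pow n"
  by (auto simp: ideal_pow_def)

lemma ideal_pow_diff: "x \<in> ideal_pow n \<Longrightarrow> y \<in> ideal_pow n \<Longrightarrow> x - y \<in> ideal_pow n"
  using ideal_pow_add[of x n "- y"] by simp

lemma ideal_pow_diff_commute: "x - y \<in> ideal_pow n \<longleftrightarrow> y - x \<in> ideal_pow n"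
  using ideal_pow_minus_iff[of "x - y" n] by simp

lemma ideal_pow_trans: "x - y \<in> ideal_pow n \<Longrightarrow> y - z \<in> ideal_pow n \<Longrightarrow> x - z \<in> ideal_pow n"
  using ideal_pow_add[of "x - y" n "y - z"] by simp

lemma ideal_pow_mult:
  "x \<in> ideal_pow m \<Longrightarrow> y \<in> ideal_pow n \<Longrightarrow> k \<le> m + n \<Longrightarrow> x * y \<in> ideal_pow k"
  by (cases "x = 0 \<or> y = 0") (auto simp: ideal_pow_def ord_mult)

lemma ideal_pow_mono: "m \<le> n \<Longrightarrow> x \<in> ideal_pow n \<Longrightarrow> x \<in> ideal_pow m"
  by (auto simp: ideal_pow_def)

lemma in_ideal_pow_ord: "n \<le> ord x \<Longrightarrow> x \<in> ideal_pow n"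
  by (simp add: ideal_pow_def)

lemma ord_add_dominant:
  assumes "x \<noteq> 0" "y \<in> ideal_pow (ord x + 1)"
  shows "x + y \<noteq> 0" "ord (x + y) = ord x"
proof -
  show nz: "x + y \<noteq> 0"
  proof
    assume "x + y = 0"
    then have "x = - y" by (simp add: eq_neg_iff_add_eq_0)
    then show False using assms by (auto simp: ideal_pow_def)
  qed
  show "ord (x + y) = ord x"
  proof (cases "y = 0")
    case False
    then have "ord x < ord y" using assms by (simp add: ideal_pow_def)
    moreover have "min (ord x) (ord y) \<le> ord (x + y)"
      using ord_add[of x y] assms(1) False nz by simp
    \<comment> \<open>The reverse bound comes from x = (x + y) - y.\<close>
    moreover have "min (ord (x + y)) (ord (- y)) \<le> ord x"
      using ord_add[of "x + y" "- y"] assms(1) False nz by simp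
    ultimately show ?thesis by (simp add: min_def split: if_splits)
  qed simp
qed

lemma one_add_max_ideal:
  assumes "u \<in> ideal_pow 1"
  shows "1 + u \<noteq> 0" "ord (1 + u) = 0"
  using ord_add_dominant[of 1 u] assms by auto

lemma ord_scale_one_add:
  assumes "u \<in> ideal_pow 1" "x \<noteq> 0"
  shows "x * (1 + u) \<noteq> 0" "ord (x * (1 + u)) = ord x"
  using one_add_max_ideal[OF assms(1)] assms(2) by (auto simp: ord_mult)

lemma ord_cong:
  assumes "x \<noteq> 0" "y - x \<in> ideal_pow (ord x + 1)"
  shows "y \<noteq> 0" "ord y = ord x"
  using ord_add_dominant[OF assms] by auto

section \<open>The residue field and its representatives\<close>

lemma one_not_in_ideal_pow: "0 < n \<Longrightarrow> 1 \<notin> ideal_pow n"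
  by (simp add: ideal_pow_def)

lemma of_nat_in_ideal_pow: "of_nat n \<in> ideal_pow 0"
  by (induction n) (auto intro!: ideal_pow_add simp: in_ideal_pow_ord)

lemma ord_two:
  assumes "(2::'a::discretely_valued_field) \<notin> max_ideal"
  shows "(2::'a) \<noteq> 0" "ord (2::'a) = 0"
proof -
  show "(2::'a) \<noteq> 0" using assms by (auto simp: max_ideal_def)
  then show "ord (2::'a) = 0"
    using assms of_nat_in_ideal_pow[of 2, where ?'a='a] by (auto simp: max_ideal_eq ideal_pow_def)
qed

text \<open>The classes of 0 and 1 differ. With q > 1 the radii q^(-n) tend to 0, so the powers of p
  are a neighbourhood base at 0.\<close>

lemma residue_classes_ge_two:
  assumes "finite (residue_classes :: 'a::discretely_valued_field set set)"
  shows "2 \<le> card (residue_classes :: 'a set set)"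
proof -
  let ?c = "\<lambda>a::'a. {x. x - a \<in> max_ideal}"
  have "1 \<in> ?c 1" "1 \<notin> ?c 0"
    using one_not_in_ideal_pow[of 1] by (auto simp: max_ideal_eq)
  then have "?c 1 \<noteq> ?c 0" by blast
  moreover have "?c 1 \<in> residue_classes" "?c 0 \<in> residue_classes"
    unfolding residue_classes_def by (intro imageI, simp add: integer_ring_def)+
  ultimately have "card {?c 1, ?c 0} \<le> card (residue_classes :: 'a set set)"
    by (intro card_mono assms) auto
  then show ?thesis using \<open>?c 1 \<noteq> ?c 0\<close> by simp
qed

lemma residue_representatives:
  assumes "finite (residue_classes :: 'a::discretely_valued_field set set)"
  obtains R :: "'a::discretely_valued_field set" where "finite R" "R \<subseteq> ideal_pow 0"
    "\<And>x. x \<in> ideal_pow 0 \<Longrightarrow> \<exists>r\<in>R. x - r \<in> ideal_pow 1"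
    "\<And>r r'. r \<in> R \<Longrightarrow> r' \<in> R \<Longrightarrow> r - r' \<in> ideal_pow 1 \<Longrightarrow> r = r'"
proof -
  let ?c = "\<lambda>a::'a. {x. x - a \<in> max_ideal}"
  define rep where "rep C = (SOME a. a \<in> integer_ring \<and> C = ?c a)" for C
  have rep: "rep C \<in> integer_ring \<and> C = ?c (rep C)" if "C \<in> residue_classes" for C
    unfolding rep_def by (rule someI_ex) (use that in \<open>auto simp: residue_classes_def\<close>)
  show ?thesis
  proof (rule that[of "rep ` residue_classes"])
    show "finite (rep ` residue_classes)" using assms by simp
    show "rep ` residue_classes \<subseteq> ideal_pow 0" using rep by (auto simp: integer_ring_eq)
    show "\<exists>r\<in>rep ` residue_classes. x - r \<in> ideal_pow 1" if "x \<in> ideal_pow 0" for x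
    proof (rule bexI)
      have C: "?c x \<in> residue_classes"
        using that by (auto simp: residue_classes_def integer_ring_eq)
      then show "rep (?c x) \<in> rep ` residue_classes" by simp
      have "x \<in> ?c x" by (simp add: max_ideal_eq)
      also have "\<dots> = ?c (rep (?c x))" using rep[OF C] by blast
      finally show "x - rep (?c x) \<in> ideal_pow 1" by (simp add: max_ideal_eq)
    qed
    fix r r'
    assume "r \<in> rep ` residue_classes" "r' \<in> rep ` residue_classes" and d: "r - r' \<in> ideal_pow 1"
    then obtain C C' where C: "r = rep C" "C \<in> residue_classes" "r' = rep C'" "C' \<in> residue_classes"
      by auto
    have "?c r = ?c r'"
      using d ideal_pow_trans[of _ r 1 r'] ideal_pow_trans[of _ r' 1 r]
        ideal_pow_diff_commute[of r r' 1] by (auto simp: max_ideal_eq)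
    then have "C = C'" using rep[OF C(2)] rep[OF C(4)] C(1,3) by simp
    then show "r = r'" using C by simp
  qed
qed

section \<open>The topology of a local field\<close>

lemma card_residue_classes_gt_one: "1 < real (card (residue_classes :: 'k::nonarch_local_field set set))"
  using residue_classes_ge_two[where ?'a='k, OF finite_residue_classes] by simp

text \<open>This is the bridge between metric and valuation: closed balls of radius q^(-n) are the
  cosets of p^n, because m \<mapsto> q^m is strictly increasing.\<close>

lemma dist_le_powi_iff:
  fixes x y :: "'k::nonarch_local_field"
  shows "dist x y \<le> real (card (residue_classes :: 'k set set)) powi (- n) \<longleftrightarrow> x - y \<in> ideal_pow n"
proof (cases "x = y")
  case False
  let ?q = "real (card (residue_classes :: 'k set set))"
  have q: "1 < ?q" by (rule card_residue_classes_gt_one)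
  have "?q powi (- ord (x - y)) \<le> ?q powi (- n) \<longleftrightarrow> n \<le> ord (x - y)"
    using power_int_strict_increasing[of "- n" "- ord (x - y)" ?q]
      power_int_increasing[of "- ord (x - y)" "- n" ?q] q by (meson less_imp_le linorder_not_less neg_le_iff_le neg_less_iff_less)
  then show ?thesis using False by (simp add: dist_norm_val norm_val_def ideal_pow_def)
qed simp

lemma dist_ord:
  fixes x y :: "'k::nonarch_local_field"
  assumes "x \<noteq> y"
  shows "dist x y = real (card (residue_classes :: 'k set set)) powi (- ord (x - y))"
  using assms by (simp add: dist_norm_val norm_val_def)

lemma dist_eqI:
  fixes x y z w :: "'k::nonarch_local_field"
  assumes "x = y \<longleftrightarrow> z = w" "x \<noteq> y \<Longrightarrow> z \<noteq> w \<Longrightarrow> ord (x - y) = ord (z - w)"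
  shows "dist x y = dist z w"
  using assms by (cases "x = y") (simp_all add: dist_ord)

lemma ideal_pow_coset_cball:
  "{x. x - a \<in> ideal_pow n} =
    cball (a::'k::nonarch_local_field) (real (card (residue_classes :: 'k set set)) powi (- n))"
  by (auto simp: mem_cball dist_commute[of a] dist_le_powi_iff)

lemma powi_below:
  fixes e :: real
  assumes "1 < q" "0 < e"
  obtains n :: nat where "q powi (- int n) < e"
proof -
  obtain n where "(1 / q) ^ n < e"
    using real_arch_pow_inv[of e "1 / q"] assms by auto
  then show thesis using that[of n] assms by (simp add: power_int_minus power_one_over inverse_eq_divide)
qed

lemma open_contains_coset:
  fixes U :: "'k::nonarch_local_field set"
  assumes "open U" "a \<in> U"
  obtains n where "{x. x - a \<in> ideal_pow n} \<subseteq> U"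
proof -
  obtain e where e: "0 < e" "ball a e \<subseteq> U"
    using assms by (meson open_contains_ball)
  obtain n where "real (card (residue_classes :: 'k set set)) powi (- int n) < e"
    using powi_below[OF card_residue_classes_gt_one e(1)] by metis
  then have "{x. x - a \<in> ideal_pow (int n)} \<subseteq> ball a e"
    unfolding ideal_pow_coset_cball by auto
  then show thesis using e(2) that by blast
qed

lemma open_coset: "open {x. x - (a::'k::nonarch_local_field) \<in> ideal_pow n}"
proof -
  let ?q = "real (card (residue_classes :: 'k set set))"
  have "ball x (?q powi (- n)) \<subseteq> {x. x - a \<in> ideal_pow n}" if x: "x - a \<in> ideal_pow n" for x
  proof
    fix y assume "y \<in> ball x (?q powi (- n))"
    then have "y - x \<in> ideal_pow n"
      by (simp add: dist_commute[of x] flip: dist_le_powi_iff)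
    then show "y \<in> {x. x - a \<in> ideal_pow n}" using ideal_pow_trans[OF _ x] by simp
  qed
  moreover have "0 < ?q powi (- n)" using card_residue_classes_gt_one[where ?'k='k] by simp
  ultimately show ?thesis unfolding open_contains_ball by blast
qed

lemma open_ideal_pow: "open (ideal_pow n :: 'k::nonarch_local_field set)"
  using open_coset[of 0 n] by simp

lemma ord_sphere_eq: "ord_sphere n = ideal_pow n - ideal_pow (n + 1)"
  by (auto simp: ord_sphere_def ideal_pow_def)

lemma coset_borel [measurable]: "{x. x - (a::'k::nonarch_local_field) \<in> ideal_pow n} \<in> sets borel"
  by (simp add: open_coset)

lemma ideal_pow_borel [measurable]: "(ideal_pow n :: 'k::nonarch_local_field set) \<in> sets borel"
  by (simp add: open_ideal_pow)

lemma ord_sphere_borel [measurable]: "(ord_sphere n :: 'k::nonarch_local_field set) \<in> sets borel"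
  unfolding ord_sphere_eq by measurable

text \<open>Digit expansion: the remainder modulo p^(n+k), divided by an element of order n + k, is
  integral and can be rounded to one of finitely many residue representatives.\<close>

lemma finite_cover_ideal_pow:
  obtains A :: "'k::nonarch_local_field set"
  where "finite A" "\<And>x. x \<in> ideal_pow n \<Longrightarrow> \<exists>a\<in>A. x - a \<in> ideal_pow (n + int k)"
proof -
  obtain R :: "'k set" where R: "finite R"
    "\<And>x. x \<in> ideal_pow 0 \<Longrightarrow> \<exists>r\<in>R. x - r \<in> ideal_pow 1"
    using residue_representatives[OF finite_residue_classes] by metis
  have "\<exists>A::'k set. finite A \<and> (\<forall>x\<in>ideal_pow n. \<exists>a\<in>A. x - a \<in> ideal_pow (n + int k))"
  proof (induction k)
    case 0
    show ?case by (intro exI[of _ "{0}"]) auto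
  next
    case (Suc k)
    then obtain A :: "'k set" where A: "finite A"
      "\<And>x. x \<in> ideal_pow n \<Longrightarrow> \<exists>a\<in>A. x - a \<in> ideal_pow (n + int k)" by auto
    obtain p :: 'k where p: "p \<noteq> 0" "ord p = n + int k" using ord_surj by blast
    have "\<exists>b\<in>(\<lambda>(a, r). a + p * r) ` (A \<times> R). x - b \<in> ideal_pow (n + int (Suc k))"
      if x: "x \<in> ideal_pow n" for x :: 'k
    proof -
      obtain a where a: "a \<in> A" "x - a \<in> ideal_pow (n + int k)" using A(2) x by blast
      have "(x - a) * inverse p \<in> ideal_pow 0"
        by (rule ideal_pow_mult[OF a(2), of _ "- (n + int k)"])
          (use p in \<open>auto simp: ideal_pow_def ord_inverse\<close>)
      then obtain r where r: "r \<in> R" "(x - a) * inverse p - r \<in> ideal_pow 1" using R by blast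
      have "p * ((x - a) * inverse p - r) \<in> ideal_pow (n + int (Suc k))"
        by (rule ideal_pow_mult[OF _ r(2), of _ "n + int k"]) (use p in \<open>auto simp: ideal_pow_def\<close>)
      moreover have "p * ((x - a) * inverse p - r) = x - (a + p * r)"
        using p by (simp add: field_simps)
      ultimately show ?thesis using a r by force
    qed
    then show ?case using A R by (intro exI[of _ "(\<lambda>(a, r). a + p * r) ` (A \<times> R)"]) auto
  qed
  then show thesis using that by blast
qed

lemma countable_dense_cosets:
  obtains D :: "'k::nonarch_local_field set"
  where "countable D" "\<And>x n. \<exists>d\<in>D. x - d \<in> ideal_pow n"
proof -
  have "\<exists>A::'k set. finite A \<and> (\<forall>x\<in>ideal_pow n. \<exists>a\<in>A. x - a \<in> ideal_pow (n + int k))" for n k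
    using finite_cover_ideal_pow[of n k] by metis
  then obtain A :: "int \<Rightarrow> nat \<Rightarrow> 'k set" where A: "\<And>n k. finite (A n k)"
    "\<And>n k x. x \<in> ideal_pow n \<Longrightarrow> \<exists>a\<in>A n k. x - a \<in> ideal_pow (n + int k)"
    by metis
  show thesis
  proof (rule that[of "\<Union>n k. A n k"])
    show "countable (\<Union>n k. A n k)"
      by (intro countable_UN) (auto intro: countable_finite A)
    show "\<exists>d\<in>\<Union>n k. A n k. x - d \<in> ideal_pow n" for x n
    proof -
      \<comment> \<open>This also holds at x = 0, whatever value \<open>ord 0\<close> has, because
        \<open>ideal_pow\<close> contains 0 by definition.\<close>
      have "x \<in> ideal_pow (ord x)" by (simp add: ideal_pow_def)
      then obtain a where a: "a \<in> A (ord x) (nat (n - ord x))"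
        "x - a \<in> ideal_pow (ord x + int (nat (n - ord x)))"
        using A(2) by blast
      then have "x - a \<in> ideal_pow n" by (intro ideal_pow_mono[OF _ a(2)]) simp
      then show ?thesis using a(1) by blast
    qed
  qed
qed

text \<open>By separability every open set is a countable union of cosets. The countable cover by
  cosets of the integer ring supplies the \<sigma>-finiteness required for uniqueness of measures on
  a generator.\<close>

lemma borel_generated_by_cosets:
  obtains C :: "'k::nonarch_local_field set set"
  where "countable C" "C \<subseteq> range (\<lambda>a. {x. x - a \<in> ideal_pow 0})" "\<Union>C = UNIV"
    "sets borel = sigma_sets UNIV (insert {} (range (\<lambda>(a::'k, n). {x. x - a \<in> ideal_pow n})))"
proof -
  let ?E = "insert {} (range (\<lambda>(a::'k, n). {x. x - a \<in> ideal_pow n}))"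
  obtain D :: "'k set" where D: "countable D" "\<And>x n. \<exists>d\<in>D. x - d \<in> ideal_pow n"
    using countable_dense_cosets by metis
  have "U \<in> sigma_sets UNIV ?E" if U: "open U" for U :: "'k set"
  proof -
    let ?F = "{V \<in> (\<lambda>(a, n). {x. x - a \<in> ideal_pow n}) ` (D \<times> UNIV). V \<subseteq> U}"
    have "countable ((\<lambda>(a, n). {x. x - a \<in> ideal_pow n}) ` (D \<times> (UNIV :: int set)))"
      by (intro countable_image countable_SIGMA D(1) countableI_type)
    then have "countable ?F" by (rule countable_subset[rotated]) blast
    moreover have "V \<in> sigma_sets UNIV ?E" if "V \<in> ?F" for V
      by (rule sigma_sets.Basic) (use that in blast)
    moreover have "\<Union>?F = U"
    proof
      show "U \<subseteq> \<Union>?F"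
      proof
        fix x assume "x \<in> U"
        then obtain n where n: "{y. y - x \<in> ideal_pow n} \<subseteq> U" using U open_contains_coset by blast
        obtain d where d: "d \<in> D" "x - d \<in> ideal_pow n" using D by blast
        have "{y. y - d \<in> ideal_pow n} \<subseteq> U"
          using n d(2) ideal_pow_trans ideal_pow_diff_commute by blast
        then show "x \<in> \<Union>?F" using d by blast
      qed
    qed blast
    ultimately show ?thesis by (metis (no_types, lifting) sigma_sets_UNION)
  qed
  then have "sets (borel :: 'k measure) \<subseteq> sigma_sets UNIV ?E"
    unfolding borel_def by simp (rule sigma_sets_mono, blast)
  moreover have "?E \<subseteq> sets borel"
    by (auto simp: coset_borel)
  then have "sigma_sets UNIV ?E \<subseteq> sets borel"
    using sets.sigma_sets_subset[of ?E "borel :: 'k measure"] by simp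
  ultimately have "sets borel = sigma_sets UNIV ?E" by blast
  moreover have "\<Union>((\<lambda>a. {x. x - a \<in> ideal_pow 0}) ` D) = UNIV" using D(2) by fast
  ultimately show thesis
    using that[of "(\<lambda>a. {x. x - a \<in> ideal_pow 0}) ` D"] D(1) by blast
qed

section \<open>Haar measure and isometries\<close>

lemma normalized_haarD:
  assumes "normalized_haar (\<mu> :: 'k::nonarch_local_field measure)"
  shows "sets \<mu> = sets borel" "space \<mu> = UNIV" "distr \<mu> borel (\<lambda>x. a + x) = \<mu>"
    "emeasure \<mu> (ideal_pow 0) = 1"
  using assms sets_eq_imp_space_eq[of \<mu> borel] by (auto simp: normalized_haar_def integer_ring_eq)

lemma borel_measurable_isometry:
  fixes \<tau> :: "'a::metric_space \<Rightarrow> 'b::metric_space"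
  assumes "\<And>x y. dist (\<tau> x) (\<tau> y) = dist x y"
  shows "\<tau> \<in> borel_measurable borel"
proof (rule borel_measurable_continuous_onI)
  show "continuous_on UNIV \<tau>"
    unfolding continuous_on_iff using assms by auto
qed

lemma haar_coset:
  assumes "normalized_haar (\<mu> :: 'k::nonarch_local_field measure)"
  shows "emeasure \<mu> {x. x - a \<in> ideal_pow n} = emeasure \<mu> (ideal_pow n)"
proof -
  have "emeasure \<mu> {x. x - a \<in> ideal_pow n} = emeasure (distr \<mu> borel (\<lambda>x. a + x)) {x. x - a \<in> ideal_pow n}"
    using normalized_haarD[OF assms] by simp
  also have "\<dots> = emeasure \<mu> ((\<lambda>x. a + x) -` {x. x - a \<in> ideal_pow n} \<inter> space \<mu>)"
  proof (rule emeasure_distr)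
    have "(\<lambda>x. a + x) \<in> borel_measurable borel"
      by (rule borel_measurable_isometry) (simp add: dist_norm_val)
    then show "(\<lambda>x. a + x) \<in> borel_measurable \<mu>"
      using normalized_haarD(1)[OF assms] measurable_cong_sets by blast
  qed simp
  also have "(\<lambda>x. a + x) -` {x. x - a \<in> ideal_pow n} \<inter> space \<mu> = ideal_pow n"
    using normalized_haarD(2)[OF assms] by auto
  finally show ?thesis .
qed

text \<open>Two cosets of powers of p are nested or disjoint, so they form, together with the empty
  set, an intersection-stable generator. A surjective isometry pulls each coset back to a coset of
  the same power, and the measures agree on the generator.\<close>

lemma haar_isometry_invariant:
  fixes \<tau> :: "'k::nonarch_local_field \<Rightarrow> 'k"
  assumes \<mu>: "normalized_haar \<mu>" and "surj \<tau>" and iso: "\<And>x y. dist (\<tau> x) (\<tau> y) = dist x y"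
  shows "distr \<mu> borel \<tau> = \<mu>"
proof -
  let ?E = "insert {} (range (\<lambda>(a::'k, n). {x. x - a \<in> ideal_pow n}))"
  obtain C :: "'k set set" where C: "countable C"
    "C \<subseteq> range (\<lambda>a. {x. x - a \<in> ideal_pow 0})" "\<Union>C = UNIV"
    "sets borel = sigma_sets UNIV ?E"
    using borel_generated_by_cosets by metis
  note h = normalized_haarD[OF \<mu>]
  have \<tau>: "\<tau> \<in> \<mu> \<rightarrow>\<^sub>M borel"
    using borel_measurable_isometry[of \<tau>] iso h(1) measurable_cong_sets by blast
  have ems: "emeasure (distr \<mu> borel \<tau>) X = emeasure \<mu> X" if X0: "X \<in> ?E" for X
  proof (cases "X = {}")
    case False
    then obtain a n where X: "X = {x. x - a \<in> ideal_pow n}" using X0 by auto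
    obtain b where b: "a = \<tau> b" using \<open>surj \<tau>\<close> by auto
    have "\<tau> -` X \<inter> space \<mu> = {x. x - b \<in> ideal_pow n}"
      unfolding X b h(2) by (auto simp: iso simp flip: dist_le_powi_iff)
    then show ?thesis
      using emeasure_distr[OF \<tau>, of X] haar_coset[OF \<mu>] by (simp add: X)
  qed simp
  have "Int_stable ?E"
  proof (rule Int_stableI)
    fix X Y assume XY: "X \<in> ?E" "Y \<in> ?E"
    show "X \<inter> Y \<in> ?E"
    proof (cases "X \<inter> Y = {}")
      case False
      then obtain c where c: "c \<in> X" "c \<in> Y" by blast
      obtain a n where X: "X = {x. x - a \<in> ideal_pow n}" using XY c by auto
      obtain b m where Y: "Y = {x. x - b \<in> ideal_pow m}" using XY c by auto
      have X': "X = {x. x - c \<in> ideal_pow n}" and Y': "Y = {x. x - c \<in> ideal_pow m}"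
        using c ideal_pow_trans ideal_pow_diff_commute unfolding X Y by blast+
      have "X \<inter> Y = {x. x - c \<in> ideal_pow (max n m)}"
        unfolding X' Y' by (auto simp: ideal_pow_def)
      then show ?thesis by auto
    qed simp
  qed
  then show ?thesis
  proof (rule measure_eqI_generator_eq_countable[of ?E UNIV _ _ C])
    show "sets (distr \<mu> borel \<tau>) = sigma_sets UNIV ?E" "sets \<mu> = sigma_sets UNIV ?E"
      using h(1) C(4) by simp_all
    show "C \<subseteq> ?E" using C(2) by auto
    show "emeasure (distr \<mu> borel \<tau>) X \<noteq> \<infinity>" if X: "X \<in> C" for X
    proof -
      obtain a where "X = {x. x - a \<in> ideal_pow 0}" using X C(2) by blast
      moreover from this have "X \<in> ?E" by auto
      ultimately show ?thesis using ems[of X] haar_coset[OF \<mu>, of a 0] h(4) by simp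
    qed
  qed (use C ems in auto)
qed

lemma haar_integrable_isometry:
  fixes f :: "'k::nonarch_local_field \<Rightarrow> complex"
  assumes \<mu>: "normalized_haar \<mu>" and \<tau>: "surj \<tau>" "\<And>x y. dist (\<tau> x) (\<tau> y) = dist x y"
    and f: "integrable \<mu> f"
  shows "integrable \<mu> (\<lambda>x. f (\<tau> x))" "(LINT x|\<mu>. f (\<tau> x)) = (LINT x|\<mu>. f x)"
proof -
  have meas: "\<tau> \<in> \<mu> \<rightarrow>\<^sub>M borel"
    using borel_measurable_isometry[of \<tau>] \<tau>(2) normalized_haarD(1)[OF \<mu>] measurable_cong_sets by blast
  have inv: "distr \<mu> borel \<tau> = \<mu>"
    by (rule haar_isometry_invariant[OF \<mu> \<tau>])
  show "integrable \<mu> (\<lambda>x. f (\<tau> x))"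
    by (rule integrable_distr[OF meas]) (simp add: inv f)
  have "f \<in> borel_measurable borel"
    using borel_measurable_integrable[OF f] normalized_haarD(1)[OF \<mu>] measurable_cong_sets by blast
  then show "(LINT x|\<mu>. f (\<tau> x)) = (LINT x|\<mu>. f x)"
    using integral_distr[OF meas, of f] by (simp add: inv)
qed

text \<open>No integrability is assumed: a non-integrable function has integral \<open>0\<close>, and
  composition with an isometry preserves non-integrability.\<close>

lemma haar_integral_isometry:
  fixes f :: "'k::nonarch_local_field \<Rightarrow> complex"
  assumes \<mu>: "normalized_haar \<mu>" and \<tau>: "bij \<tau>" "\<And>x y. dist (\<tau> x) (\<tau> y) = dist x y"
  shows "(LINT x|\<mu>. f (\<tau> x)) = (LINT x|\<mu>. f x)"
proof (cases "integrable \<mu> f")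
  case True
  then show ?thesis using haar_integrable_isometry(2)[OF \<mu> _ \<tau>(2)] \<tau>(1) bij_is_surj by blast
next
  case False
  have sf: "\<tau> (inv \<tau> x) = x" for x using \<tau>(1) by (simp add: bij_is_surj surj_f_inv_f)
  have "dist (inv \<tau> x) (inv \<tau> y) = dist x y" for x y
    using \<tau>(2)[of "inv \<tau> x" "inv \<tau> y"] sf by simp
  moreover have "surj (inv \<tau>)" using bij_imp_bij_inv[OF \<tau>(1)] bij_is_surj by blast
  ultimately have "\<not> integrable \<mu> (\<lambda>x. f (\<tau> x))"
    using haar_integrable_isometry(1)[OF \<mu>, of "inv \<tau>" "\<lambda>x. f (\<tau> x)"] False sf by auto
  then show ?thesis using False by (simp add: not_integrable_integral_eq)
qed

section \<open>Isometries of a shell\<close>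

lemma ord_sphereI: "x \<noteq> 0 \<Longrightarrow> ord x = n \<Longrightarrow> x \<in> ord_sphere n"
  and ord_sphereD: "x \<in> ord_sphere n \<Longrightarrow> x \<noteq> 0" "x \<in> ord_sphere n \<Longrightarrow> ord x = n"
  by (auto simp: ord_sphere_def)

text \<open>The right-hand side does not involve x: a point off the shell is equally far from all
  points of the shell. An isometry of the shell, extended by the identity, is thus an isometry of
  the whole field.\<close>

lemma dist_sphere_outside:
  fixes x y :: "'k::nonarch_local_field"
  assumes "x \<in> ord_sphere n" "y \<notin> ord_sphere n"
  shows "dist x y = real (card (residue_classes :: 'k set set)) powi (- (if y = 0 then n else min n (ord y)))"
proof -
  have x: "x \<noteq> 0" "ord x = n" using assms(1) ord_sphereD by auto
  consider "y = 0" | "y \<noteq> 0" "n < ord y" | "y \<noteq> 0" "ord y < n"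
    using assms(2) by (force simp: ord_sphere_def)
  then have "x \<noteq> y \<and> ord (x - y) = (if y = 0 then n else min n (ord y))"
  proof cases
    case 2
    then show ?thesis using ord_add_dominant[of x "- y"] x by (auto simp: ideal_pow_def)
  next
    case 3
    then show ?thesis
      using ord_add_dominant[of y "- x"] x ord_diff_commute[of x y] by (auto simp: ideal_pow_def)
  qed (use x in auto)
  then show ?thesis by (simp add: dist_ord)
qed

lemma shell_integral_isometry:
  fixes f :: "'k::nonarch_local_field \<Rightarrow> complex"
  assumes \<mu>: "normalized_haar \<mu>" and bij: "bij_betw \<tau> (ord_sphere n) (ord_sphere n)"
    and iso: "\<And>x y. x \<in> ord_sphere n \<Longrightarrow> y \<in> ord_sphere n \<Longrightarrow> dist (\<tau> x) (\<tau> y) = dist x y"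
  shows "(LINT x:ord_sphere n|\<mu>. f (\<tau> x)) = (LINT x:ord_sphere n|\<mu>. f x)"
proof -
  let ?S = "ord_sphere n :: 'k set"
  define \<sigma> where "\<sigma> x = (if x \<in> ?S then \<tau> x else x)" for x
  have S: "\<tau> x \<in> ?S" if "x \<in> ?S" for x
    using bij that by (auto simp: bij_betw_def)
  have "bij \<sigma>"
  proof -
    have "bij_betw \<sigma> ?S ?S" using bij by (simp add: \<sigma>_def cong: bij_betw_cong)
    moreover have "bij_betw \<sigma> (- ?S) (- ?S)"
      by (rule bij_betw_cong[THEN iffD2, OF _ bij_betw_id]) (simp add: \<sigma>_def)
    ultimately show ?thesis
      using bij_betw_combine[of \<sigma> ?S ?S "- ?S" "- ?S"] by auto
  qed
  moreover have "dist (\<sigma> x) (\<sigma> y) = dist x y" for x y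
    using iso S dist_sphere_outside[of x n y] dist_sphere_outside[of "\<tau> x" n y]
      dist_sphere_outside[of y n x] dist_sphere_outside[of "\<tau> y" n x]
    by (cases "x \<in> ?S"; cases "y \<in> ?S") (simp_all add: \<sigma>_def dist_commute)
  ultimately have "(LINT x|\<mu>. indicator ?S (\<sigma> x) *\<^sub>R f (\<sigma> x)) = (LINT x|\<mu>. indicator ?S x *\<^sub>R f x)"
    by (rule haar_integral_isometry[OF \<mu>])
  moreover have "(\<lambda>x. indicator ?S (\<sigma> x) *\<^sub>R f (\<sigma> x)) = (\<lambda>x. indicator ?S x *\<^sub>R f (\<tau> x))"
    using S by (auto simp: fun_eq_iff \<sigma>_def indicator_def)
  ultimately show ?thesis unfolding set_lebesgue_integral_def by simp
qed

lemma shell_integral_cong: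
  assumes "normalized_haar (\<mu> :: 'k::nonarch_local_field measure)" "\<And>x. x \<in> ord_sphere n \<Longrightarrow> f x = g x"
  shows "(LINT x:ord_sphere n|\<mu>. f x) = (LINT x:ord_sphere n|\<mu>. g x)"
  by (rule set_lebesgue_integral_cong) (auto simp: assms(2) normalized_haarD(1)[OF assms(1)])

text \<open>Invariance turns the integral I into \<zeta> I. Every cancellation on a shell below is
  reduced to this.\<close>

lemma shell_integral_eigenfunction:
  fixes f :: "'k::nonarch_local_field \<Rightarrow> complex"
  assumes \<mu>: "normalized_haar \<mu>" and bij: "bij_betw \<tau> (ord_sphere n) (ord_sphere n)"
    and iso: "\<And>x y. x \<in> ord_sphere n \<Longrightarrow> y \<in> ord_sphere n \<Longrightarrow> dist (\<tau> x) (\<tau> y) = dist x y"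
    and f: "\<And>x. x \<in> ord_sphere n \<Longrightarrow> f (\<tau> x) = \<zeta> * f x" and "\<zeta> \<noteq> 1"
  shows "(LINT x:ord_sphere n|\<mu>. f x) = 0"
proof -
  have "(LINT x:ord_sphere n|\<mu>. f x) = (LINT x:ord_sphere n|\<mu>. f (\<tau> x))"
    using shell_integral_isometry[OF \<mu> bij iso] by simp
  also have "\<dots> = (LINT x:ord_sphere n|\<mu>. \<zeta> * f x)"
    using shell_integral_cong[OF \<mu> f] .
  also have "\<dots> = \<zeta> * (LINT x:ord_sphere n|\<mu>. f x)" by simp
  finally show ?thesis using \<open>\<zeta> \<noteq> 1\<close> by simp
qed

text \<open>Choosing the factor \<open>1 + u\<close> separately on each coset of \<open>ideal_pow (n + 1)\<close> still
  gives an isometry of the shell, because elements of different cosets have distance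
  equal to their absolute value.\<close>

lemma shell_integral_local_scaling:
  fixes f :: "'k::nonarch_local_field \<Rightarrow> complex"
  assumes \<mu>: "normalized_haar \<mu>" and "\<zeta> \<noteq> 1"
    and u: "\<And>x0. x0 \<in> ord_sphere n \<Longrightarrow> \<exists>u\<in>ideal_pow 1. \<forall>x. x - x0 \<in> ideal_pow (n + 1) \<longrightarrow>
      f (x * (1 + u)) = \<zeta> * f x"
  shows "(LINT x:ord_sphere n|\<mu>. f x) = 0"
proof -
  let ?S = "ord_sphere n :: 'k set"
  obtain u :: "'k \<Rightarrow> 'k" where u: "\<And>x0. x0 \<in> ?S \<Longrightarrow> u x0 \<in> ideal_pow 1"
    "\<And>x0 x. x0 \<in> ?S \<Longrightarrow> x - x0 \<in> ideal_pow (n + 1) \<Longrightarrow> f (x * (1 + u x0)) = \<zeta> * f x"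
    using u by metis
  define rep where "rep x = (SOME y. y - x \<in> ideal_pow (n + 1))" for x :: 'k
  have rep: "rep x - x \<in> ideal_pow (n + 1)" for x
    unfolding rep_def by (rule someI[of _ x]) simp
  \<comment> \<open>Points of one coset give the same predicate to \<open>SOME\<close>, hence the
    same representative; so the factor \<open>v\<close> is constant on cosets.\<close>
  have rep_cong: "rep x = rep y" if "x - y \<in> ideal_pow (n + 1)" for x y
  proof -
    have "z - x \<in> ideal_pow (n + 1) \<longleftrightarrow> z - y \<in> ideal_pow (n + 1)" for z
      using that ideal_pow_trans ideal_pow_diff_commute by blast
    then show ?thesis by (simp add: rep_def)
  qed
  have repS: "rep x \<in> ?S" if "x \<in> ?S" for x
    using ord_cong[of x "rep x"] rep[of x] that by (auto simp: ord_sphere_def)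
  define v where "v x = 1 + u (rep x)" for x
  have v: "v x \<noteq> 0" "ord (v x) = 0" "v x - 1 \<in> ideal_pow 1" if "x \<in> ?S" for x
    using one_add_max_ideal[OF u(1)[OF repS[OF that]]] u(1)[OF repS[OF that]] by (auto simp: v_def)
  have S: "x * v x \<in> ?S" if "x \<in> ?S" for x
    using v[OF that] that by (auto simp: ord_sphere_def ord_mult)
  have near: "x * v y - x \<in> ideal_pow (n + 1)" if "x \<in> ?S" "y \<in> ?S" for x y
  proof -
    have "x * (v y - 1) \<in> ideal_pow (n + 1)"
      by (rule ideal_pow_mult[OF _ v(3)[OF that(2)], of _ n]) (use that in \<open>auto simp: ord_sphere_def ideal_pow_def\<close>)
    then show ?thesis by (simp add: algebra_simps)
  qed
  have v_cong: "v x = v y" if "x - y \<in> ideal_pow (n + 1)" for x y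
    using rep_cong[OF that] by (simp add: v_def)
  have iso: "dist (x * v x) (y * v y) = dist x y" if "x \<in> ?S" "y \<in> ?S" for x y
  proof (cases "x - y \<in> ideal_pow (n + 1)")
    case True
    then have "x * v x - y * v y = (x - y) * v x"
      using v_cong by (simp add: algebra_simps)
    then show ?thesis
      using v[OF that(1)] by (intro dist_eqI) (auto simp: ord_mult)
  next
    case False
    have d: "ord (x - y) = n" "x - y \<noteq> 0"
      using False ideal_pow_diff[of x n y] that by (auto simp: ideal_pow_def ord_sphere_def)
    have "(x * v x - x) - (y * v y - y) \<in> ideal_pow (n + 1)"
      by (rule ideal_pow_diff[OF near near]) (use that in auto)
    then have "(x * v x - y * v y) - (x - y) \<in> ideal_pow (ord (x - y) + 1)"
      using d by (simp add: algebra_simps)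
    from ord_cong[OF d(2) this] show ?thesis using d by (intro dist_eqI) auto
  qed
  have "bij_betw (\<lambda>x. x * v x) ?S ?S"
  proof (rule bij_betw_imageI)
    show "inj_on (\<lambda>x. x * v x) ?S"
      using iso by (metis (no_types, lifting) dist_eq_0_iff inj_onI)
    show "(\<lambda>x. x * v x) ` ?S = ?S"
    proof
      show "?S \<subseteq> (\<lambda>x. x * v x) ` ?S"
      proof
        fix y assume y: "y \<in> ?S"
        \<comment> \<open>Division by \<open>v y\<close> stays within the coset of y, so
          \<open>v\<close> takes the same value at the quotient and multiplication returns
          y.\<close>
        let ?x = "y / v y"
        have x: "?x \<in> ?S" using y v[OF y] by (auto simp: ord_sphere_def ord_divide)
        have y': "?x * v y = y" using v(1)[OF y] by simp
        have "v y = v ?x" using v_cong[OF near[OF x y]] unfolding y' .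
        then have "y = ?x * v ?x" using y' by simp
        then show "y \<in> (\<lambda>x. x * v x) ` ?S" using x by blast
      qed
    qed (use S in auto)
  qed
  moreover have "f (x * v x) = \<zeta> * f x" if "x \<in> ?S" for x
    unfolding v_def using u(2)[OF repS[OF that]] rep ideal_pow_diff_commute by blast
  ultimately show ?thesis
    using shell_integral_eigenfunction[OF \<mu> _ iso _ \<open>\<zeta> \<noteq> 1\<close>] by blast
qed

lemma borel_measurable_norm_val [measurable]:
  "(norm_val :: 'k::nonarch_local_field \<Rightarrow> real) \<in> borel_measurable borel"
proof -
  have "(\<lambda>x::'k. dist x 0) \<in> borel_measurable borel"
    by (intro borel_measurable_continuous_onI continuous_intros)
  then show ?thesis by (simp add: dist_norm_val)
qed

text \<open>On ord x = n the density 1 / |x| is the constant q^n.\<close>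

lemma shell_integral_mult_haar:
  fixes f :: "'k::nonarch_local_field \<Rightarrow> complex"
  assumes \<mu>: "normalized_haar \<mu>"
  shows "(LINT x:ord_sphere n|mult_haar \<mu>. f x) =
    real (card (residue_classes :: 'k set set)) powi n *\<^sub>R (LINT x:ord_sphere n|\<mu>. f x)"
proof -
  let ?g = "\<lambda>x. indicator (ord_sphere n) x *\<^sub>R f x"
  have sets: "sets (mult_haar \<mu>) = sets \<mu>" by (simp add: mult_haar_def)
  show ?thesis
  proof (cases "?g \<in> borel_measurable \<mu>")
    case True
    have g: "(\<lambda>x. inverse (norm_val x)) \<in> borel_measurable \<mu>"
      using normalized_haarD(1)[OF \<mu>]
      by (simp cong: measurable_cong_sets)
    have "(LINT x|mult_haar \<mu>. ?g x) = (LINT x|\<mu>. inverse (norm_val x) *\<^sub>R ?g x)"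
      unfolding mult_haar_def
      by (rule integral_density[OF True g]) (simp add: norm_val_def)
    also have "\<dots> = (LINT x|\<mu>. real (card (residue_classes :: 'k set set)) powi n *\<^sub>R ?g x)"
      by (intro Bochner_Integration.integral_cong)
        (auto simp: indicator_def ord_sphere_def norm_val_def power_int_minus)
    also have "\<dots> = real (card (residue_classes :: 'k set set)) powi n *\<^sub>R (LINT x|\<mu>. ?g x)"
      by (rule integral_scaleR_right)
    finally show ?thesis by (simp add: set_lebesgue_integral_def)
  next
    \<comment> \<open>Without measurability neither integral exists, and both sides have the default
      value 0.\<close>
    case False
    then have "\<not> integrable \<mu> ?g" "\<not> integrable (mult_haar \<mu>) ?g"
      using borel_measurable_integrable measurable_cong_sets[OF sets refl] by blast+
    then show ?thesis by (simp add: set_lebesgue_integral_def not_integrable_integral_eq)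
  qed
qed

section \<open>Squares\<close>

text \<open>Hensel's lemma by Banach's fixed point theorem: 1 + u = (1 + w)^2 is equivalent to w =
  (u - w^2) / 2. Since 2 is a unit and x + y lies in p for x, y in p, this map contracts p by the
  factor 1 / q.\<close>

lemma one_add_max_ideal_square:
  fixes u :: "'k::nonarch_local_field"
  assumes two: "(2::'k) \<notin> max_ideal" and u: "u \<in> ideal_pow 1"
  obtains w where "w \<in> ideal_pow 1" "1 + u = (1 + w)\<^sup>2"
proof -
  let ?q = "real (card (residue_classes :: 'k set set))"
  note two' = ord_two[OF two]
  have half: "x / 2 \<in> ideal_pow n" if "x \<in> ideal_pow n" for x :: 'k and n
    using that two' by (cases "x = 0") (auto simp: ideal_pow_def ord_divide)
  have "\<exists>!w\<in>ideal_pow 1. (u - w\<^sup>2) / 2 = w"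
  proof (rule Banach_fix[where c = "inverse ?q"])
    have "ideal_pow 1 = cball (0::'k) (?q powi (- 1))"
      using ideal_pow_coset_cball[of 0 1] by simp
    then show "complete (ideal_pow 1 :: 'k set)" by (simp add: complete_eq_closed)
    show "(ideal_pow 1 :: 'k set) \<noteq> {}" using zero_in_ideal_pow by blast
    show "0 \<le> inverse ?q" "inverse ?q < 1"
      using card_residue_classes_gt_one[where ?'k='k] by (auto simp: inverse_less_1_iff)
    show "(\<lambda>w. (u - w\<^sup>2) / 2) ` ideal_pow 1 \<subseteq> ideal_pow 1"
    proof clarify
      fix w :: 'k assume "w \<in> ideal_pow 1"
      then have "w\<^sup>2 \<in> ideal_pow 1" unfolding power2_eq_square by (intro ideal_pow_mult) auto
      then show "(u - w\<^sup>2) / 2 \<in> ideal_pow 1" using u by (intro half ideal_pow_diff)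
    qed
    fix x y :: 'k assume xy: "x \<in> ideal_pow 1" "y \<in> ideal_pow 1"
    show "dist ((u - x\<^sup>2) / 2) ((u - y\<^sup>2) / 2) \<le> inverse ?q * dist x y"
    proof (cases "x = y")
      case False
      have eq: "(u - x\<^sup>2) / 2 - (u - y\<^sup>2) / 2 = ((y + x) * (y - x)) / 2"
        by (simp add: diff_divide_distrib[symmetric] power2_eq_square algebra_simps)
      have "(y + x) * (y - x) \<in> ideal_pow (1 + ord (x - y))"
        by (rule ideal_pow_mult[of _ 1 _ "ord (x - y)"])
          (use ideal_pow_add[OF xy(2,1)] ord_diff_commute[of x y] in \<open>auto intro: in_ideal_pow_ord\<close>)
      then have "dist ((u - x\<^sup>2) / 2) ((u - y\<^sup>2) / 2) \<le> ?q powi (- (1 + ord (x - y)))"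
        unfolding dist_le_powi_iff eq by (rule half)
      also have "\<dots> = inverse ?q * dist x y"
        using False card_residue_classes_gt_one[where ?'k='k]
        by (simp add: dist_ord power_int_diff power_int_minus field_simps)
      finally show ?thesis .
    qed simp
  qed
  then obtain w where w: "w \<in> ideal_pow 1" "(u - w\<^sup>2) / 2 = w" by blast
  then have "u - w\<^sup>2 = w * 2" using two'(1) by (simp add: divide_eq_eq)
  then have "1 + u = (1 + w)\<^sup>2" by (simp add: power2_eq_square algebra_simps)
  then show thesis using that w(1) by blast
qed

text \<open>The exponent 2 ord y + 1 says that x / y^2 lies in 1 + p, where square roots
  exist.\<close>

lemma near_square_is_square:
  fixes x y :: "'k::nonarch_local_field"
  assumes "(2::'k) \<notin> max_ideal" "y \<noteq> 0" "x - y\<^sup>2 \<in> ideal_pow (2 * ord y + 1)"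
  obtains w where "w \<noteq> 0" "ord w = ord y" "x = w\<^sup>2"
proof -
  have "(x - y\<^sup>2) * inverse (y\<^sup>2) \<in> ideal_pow 1"
    by (rule ideal_pow_mult[OF assms(3), of _ "- 2 * ord y"])
      (use assms(2) in \<open>auto simp: ideal_pow_def ord_inverse ord_power2\<close>)
  then obtain w where w: "w \<in> ideal_pow 1" "1 + (x - y\<^sup>2) * inverse (y\<^sup>2) = (1 + w)\<^sup>2"
    using one_add_max_ideal_square[OF assms(1)] by blast
  have "x = y\<^sup>2 * (1 + (x - y\<^sup>2) * inverse (y\<^sup>2))" using assms(2) by (simp add: field_simps)
  then have "x = (y * (1 + w))\<^sup>2" by (simp add: w(2) power_mult_distrib)
  then show thesis using that[of "y * (1 + w)"] ord_scale_one_add[OF w(1) assms(2)] by simp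
qed

section \<open>Squares and non-squares among the non-zero residue classes\<close>

definition unit_residue_system :: "'k::discretely_valued_field set \<Rightarrow> bool" where
  "unit_residue_system R \<longleftrightarrow> finite R \<and> R \<subseteq> ord_sphere 0 \<and>
     (\<forall>x\<in>ord_sphere 0. \<exists>r\<in>R. x - r \<in> ideal_pow 1) \<and>
     (\<forall>r\<in>R. \<forall>r'\<in>R. r - r' \<in> ideal_pow 1 \<longrightarrow> r = r')"

lemma unit_residue_system_exists:
  obtains R :: "'k::nonarch_local_field set" where "unit_residue_system R"
proof -
  obtain R :: "'k set" where R: "finite R" "R \<subseteq> ideal_pow 0"
    "\<And>x. x \<in> ideal_pow 0 \<Longrightarrow> \<exists>r\<in>R. x - r \<in> ideal_pow 1"
    "\<And>r r'. r \<in> R \<Longrightarrow> r' \<in> R \<Longrightarrow> r - r' \<in> ideal_pow 1 \<Longrightarrow> r = r'"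
    using residue_representatives[OF finite_residue_classes] by metis
  have "\<exists>r\<in>R \<inter> ord_sphere 0. x - r \<in> ideal_pow 1" if x: "x \<in> ord_sphere 0" for x :: 'k
  proof -
    have "x \<in> ideal_pow 0" using x by (simp add: ord_sphere_eq)
    then obtain r where r: "r \<in> R" "x - r \<in> ideal_pow 1" using R(3) by blast
    have "r \<in> ord_sphere 0"
      using ord_cong[of x r] r(2) x ideal_pow_diff_commute[of x r] by (auto simp: ord_sphere_def)
    then show ?thesis using r by blast
  qed
  then show thesis
    using that[of "R \<inter> ord_sphere 0"] R(1,4) by (auto simp: unit_residue_system_def)
qed

lemma sphere_zero_mult: "x \<in> ord_sphere 0 \<Longrightarrow> y \<in> ord_sphere 0 \<Longrightarrow> x * y \<in> ord_sphere 0"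
  and sphere_zero_divide: "x \<in> ord_sphere 0 \<Longrightarrow> y \<in> ord_sphere 0 \<Longrightarrow> x / y \<in> ord_sphere 0"
  and sphere_zero_power2: "x \<in> ord_sphere 0 \<Longrightarrow> x\<^sup>2 \<in> ord_sphere 0"
  and sphere_zero_minus: "x \<in> ord_sphere 0 \<Longrightarrow> - x \<in> ord_sphere 0"
  by (auto simp: ord_sphere_def ord_mult ord_divide ord_power2)

lemma sphere_zero_ideal: "x \<in> ord_sphere 0 \<Longrightarrow> x \<in> ideal_pow 0"
  by (simp add: ord_sphere_eq)

lemma unit_mult_ideal_pow_iff:
  assumes "v \<in> ord_sphere 0"
  shows "v * x \<in> ideal_pow n \<longleftrightarrow> x \<in> ideal_pow n"
  using assms by (cases "x = 0") (auto simp: ord_sphere_def ideal_pow_def ord_mult)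

lemma max_ideal_prime:
  assumes "x * y \<in> ideal_pow 1" "x \<in> ideal_pow 0" "y \<in> ideal_pow 0"
  shows "x \<in> ideal_pow 1 \<or> y \<in> ideal_pow 1"
  using assms by (cases "x = 0 \<or> y = 0") (auto simp: ideal_pow_def ord_mult)

lemma squares_congruent:
  assumes "x\<^sup>2 - y\<^sup>2 \<in> ideal_pow 1" "x \<in> ideal_pow 0" "y \<in> ideal_pow 0"
  shows "x - y \<in> ideal_pow 1 \<or> x + y \<in> ideal_pow 1"
proof -
  have "(x - y) * (x + y) \<in> ideal_pow 1"
    using assms(1) by (simp add: power2_eq_square algebra_simps)
  then show ?thesis
    using max_ideal_prime ideal_pow_diff[OF assms(2,3)] ideal_pow_add[OF assms(2,3)] by blast
qed

lemma nonsquare_unitD: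
  assumes "nonsquare_unit u"
  shows "u \<in> ord_sphere 0" "\<And>y. y \<in> ideal_pow 0 \<Longrightarrow> u - y\<^sup>2 \<notin> ideal_pow 1"
  using assms by (auto simp: nonsquare_unit_def ord_sphere_def integer_ring_eq max_ideal_eq)

text \<open>Each fibre of \<open>(r, i) \<mapsto> u\<^sup>i r\<^sup>2\<close> on the non-zero residue classes has at most two
  elements, hence exactly two, because there are twice as many pairs as classes.\<close>

lemma square_fibre_card:
  fixes u :: "'k::nonarch_local_field"
  assumes R: "unit_residue_system R" and u: "nonsquare_unit u" and s: "s \<in> R"
  shows "card {(r, i) \<in> R \<times> (UNIV :: bool set). (if i then u else 1) * r\<^sup>2 - s \<in> ideal_pow 1} = 2"
proof -
  define c where "c i = (if i then u else 1)" for i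
  have c: "c i \<in> ord_sphere 0" for i
    using nonsquare_unitD(1)[OF u] by (auto simp: c_def ord_sphere_def)
  note R' = R[unfolded unit_residue_system_def]
  define T where "T = R \<times> (UNIV :: bool set)"
  define \<rho> where "\<rho> x = (SOME r. r \<in> R \<and> x - r \<in> ideal_pow 1)" for x
  have \<rho>: "\<rho> x \<in> R \<and> x - \<rho> x \<in> ideal_pow 1" if "x \<in> ord_sphere 0" for x
    unfolding \<rho>_def by (rule someI_ex) (use R' that in blast)
  define g where "g = (\<lambda>(r, i). \<rho> (c i * r\<^sup>2))"
  have unit: "c i * r\<^sup>2 \<in> ord_sphere 0" if "r \<in> R" for r i
    using R' c that by (blast intro: sphere_zero_mult sphere_zero_power2)
  have g_eq: "g (r, i) = s \<longleftrightarrow> c i * r\<^sup>2 - s \<in> ideal_pow 1" if "r \<in> R" "s \<in> R" for r i s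
  proof
    assume "g (r, i) = s"
    then show "c i * r\<^sup>2 - s \<in> ideal_pow 1" using \<rho>[OF unit[OF that(1)]] by (auto simp: g_def)
  next
    assume s': "c i * r\<^sup>2 - s \<in> ideal_pow 1"
    have "g (r, i) - c i * r\<^sup>2 \<in> ideal_pow 1"
      using \<rho>[OF unit[OF that(1), of i]] ideal_pow_diff_commute by (auto simp: g_def)
    from ideal_pow_trans[OF this s'] show "g (r, i) = s" using \<rho>[OF unit[OF that(1), of i]] R' that(2) by (auto simp: g_def)
  qed
  have le: "card {t \<in> T. g t = s} \<le> 2" if s: "s \<in> R" for s
  proof (cases "{t \<in> T. g t = s} = {}")
    case False
    then obtain r i where ri: "r \<in> R" "c i * r\<^sup>2 - s \<in> ideal_pow 1"
      using g_eq[OF _ s] by (auto simp: T_def)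
    have rO: "r \<in> ord_sphere 0" using R' ri by blast
    have "t \<in> {(r, i), (\<rho> (- r), i)}" if t: "t \<in> T" "g t = s" for t
    proof -
      obtain r' j where t': "t = (r', j)" "r' \<in> R" using t by (auto simp: T_def)
      then have "c j * r'\<^sup>2 - s \<in> ideal_pow 1" using t g_eq[OF t'(2) s] by simp
      then have eq: "c i * r\<^sup>2 - c j * r'\<^sup>2 \<in> ideal_pow 1"
        using ri(2) ideal_pow_trans ideal_pow_diff_commute by blast
      have r'O: "r' \<in> ord_sphere 0" using R' t'(2) by blast
      \<comment> \<open>A class that is both a square and u times a square would make u a square
        modulo p.\<close>
      have key: False if "u * x\<^sup>2 - y\<^sup>2 \<in> ideal_pow 1" "x \<in> ord_sphere 0" "y \<in> ord_sphere 0" for x y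
      proof -
        have "x\<^sup>2 * (u - (y / x)\<^sup>2) \<in> ideal_pow 1"
          using that by (simp add: ord_sphere_def power_divide right_diff_distrib mult.commute)
        then have "u - (y / x)\<^sup>2 \<in> ideal_pow 1"
          using unit_mult_ideal_pow_iff[OF sphere_zero_power2[OF that(2)]] by blast
        then show False
          using nonsquare_unitD(2)[OF u] sphere_zero_divide[OF that(3,2)] sphere_zero_ideal by blast
      qed
      have "i = j"
        using key[of r r'] key[of r' r] eq rO r'O ideal_pow_diff_commute[of "r\<^sup>2" "u * r'\<^sup>2"]
        by (auto simp: c_def split: if_splits)
      then have "c i * (r\<^sup>2 - r'\<^sup>2) \<in> ideal_pow 1" using eq by (simp add: right_diff_distrib)
      then have "r\<^sup>2 - r'\<^sup>2 \<in> ideal_pow 1" using unit_mult_ideal_pow_iff[OF c] by blast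
      then consider "r - r' \<in> ideal_pow 1" | "r + r' \<in> ideal_pow 1"
        using squares_congruent rO r'O sphere_zero_ideal by blast
      then show ?thesis
      proof cases
        case 1
        then show ?thesis using R' ri(1) t' \<open>i = j\<close> by auto
      next
        case 2
        have p: "\<rho> (- r) \<in> R" "- r - \<rho> (- r) \<in> ideal_pow 1"
          using \<rho>[OF sphere_zero_minus[OF rO]] by auto
        have "r' - (- r) \<in> ideal_pow 1" using 2 by (simp add: add.commute)
        then have "r' - \<rho> (- r) \<in> ideal_pow 1" using p(2) ideal_pow_trans by blast
        then show ?thesis using R' p(1) t' \<open>i = j\<close> by auto
      qed
    qed
    then have "{t \<in> T. g t = s} \<subseteq> {(r, i), (\<rho> (- r), i)}" by blast
    then have "card {t \<in> T. g t = s} \<le> card {(r, i), (\<rho> (- r), i)}" by (intro card_mono) auto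
    also have "\<dots> \<le> 2" by (simp add: card_insert_if)
    finally show ?thesis .
  next
    case True
    then show ?thesis by (simp only: card.empty)
  qed
  have fin: "finite R" "finite T" using R' by (auto simp: T_def)
  have "g ` T \<subseteq> R" using \<rho>[OF unit] by (auto simp: g_def T_def)
  then have "(\<Sum>s\<in>R. \<Sum>t\<in>{t \<in> T. g t = s}. 1::nat) = (\<Sum>t\<in>T. 1)"
    by (intro sum.group fin)
  then have "(\<Sum>s\<in>R. card {t \<in> T. g t = s}) = (\<Sum>s\<in>R. 2)"
    by (simp add: T_def card_cartesian_product)
  then have "card {t \<in> T. g t = s} = 2"
    using sum_mono_inv[of "\<lambda>s. card {t \<in> T. g t = s}" R "\<lambda>_. 2" s] le s fin by blast
  moreover have "{t \<in> T. g t = s} =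
      {(r, i) \<in> R \<times> (UNIV :: bool set). (if i then u else 1) * r\<^sup>2 - s \<in> ideal_pow 1}"
  proof (rule set_eqI)
    fix t :: "'k \<times> bool"
    obtain r i where t: "t = (r, i)" by (cases t)
    show "t \<in> {t \<in> T. g t = s} \<longleftrightarrow>
        t \<in> {(r, i) \<in> R \<times> (UNIV :: bool set). (if i then u else 1) * r\<^sup>2 - s \<in> ideal_pow 1}"
      using g_eq[OF _ s, of r i] by (cases "r \<in> R") (simp_all add: t T_def c_def)
  qed
  ultimately show ?thesis by simp
qed

lemma square_class_dichotomy:
  fixes u w :: "'k::nonarch_local_field"
  assumes u: "nonsquare_unit u" and w: "w \<in> ord_sphere 0"
  obtains r where "r \<in> ord_sphere 0" "w - r\<^sup>2 \<in> ideal_pow 1 \<or> w - u * r\<^sup>2 \<in> ideal_pow 1"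
proof -
  obtain R :: "'k set" where R: "unit_residue_system R" using unit_residue_system_exists by blast
  then obtain s where s: "s \<in> R" "w - s \<in> ideal_pow 1" using w by (auto simp: unit_residue_system_def)
  have "{(r, i) \<in> R \<times> (UNIV :: bool set). (if i then u else 1) * r\<^sup>2 - s \<in> ideal_pow 1} \<noteq> {}"
    using square_fibre_card[OF R u s(1)] by (metis card.empty zero_neq_numeral)
  then obtain r and i :: bool where r: "r \<in> R" "(if i then u else 1) * r\<^sup>2 - s \<in> ideal_pow 1"
    by auto
  have "w - (if i then u else 1) * r\<^sup>2 \<in> ideal_pow 1"
    using s(2) r(2) ideal_pow_trans ideal_pow_diff_commute by blast
  then show thesis using that[of r] R r(1) by (auto simp: unit_residue_system_def split: if_splits)
qed

text \<open>The pairs (r, i) are regrouped by the class of u^i r^2, each class being hit exactly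
  twice. This takes the place of a quadratic character of the residue field.\<close>

lemma sum_over_squares:
  fixes u :: "'k::nonarch_local_field" and h :: "'k \<Rightarrow> complex"
  assumes R: "unit_residue_system R" and u: "nonsquare_unit u"
    and h: "\<And>x y. x \<in> ord_sphere 0 \<Longrightarrow> x - y \<in> ideal_pow 1 \<Longrightarrow> h x = h y"
  shows "(\<Sum>r\<in>R. h (r\<^sup>2)) + (\<Sum>r\<in>R. h (u * r\<^sup>2)) = 2 * (\<Sum>r\<in>R. h r)"
proof -
  note R' = R[unfolded unit_residue_system_def]
  define c where "c i = (if i then u else 1)" for i
  have unit: "c i * r\<^sup>2 \<in> ord_sphere 0" if "r \<in> R" for r i
    using R' nonsquare_unitD(1)[OF u] that
    by (auto simp: c_def intro!: sphere_zero_mult sphere_zero_power2)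
  have fin: "finite R" using R' by blast
  define T where "T = R \<times> (UNIV :: bool set)"
  define g where "g t = (SOME s. s \<in> R \<and> c (snd t) * (fst t)\<^sup>2 - s \<in> ideal_pow 1)" for t
  have g: "g t \<in> R \<and> c (snd t) * (fst t)\<^sup>2 - g t \<in> ideal_pow 1" if "t \<in> T" for t
    unfolding g_def by (rule someI_ex) (use R' unit[of "fst t" "snd t"] that in \<open>auto simp: T_def\<close>)
  have fibre: "{t \<in> T. g t = s} =
      {(r, i) \<in> R \<times> (UNIV :: bool set). (if i then u else 1) * r\<^sup>2 - s \<in> ideal_pow 1}"
    if s: "s \<in> R" for s
  proof (intro set_eqI)
    fix t
    have "g t = s \<longleftrightarrow> c (snd t) * (fst t)\<^sup>2 - s \<in> ideal_pow 1" if "t \<in> T"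
    proof
      assume "c (snd t) * (fst t)\<^sup>2 - s \<in> ideal_pow 1"
      then have "g t - s \<in> ideal_pow 1"
        using g[OF that] ideal_pow_trans ideal_pow_diff_commute by blast
      then show "g t = s" using R' s g[OF that] by blast
    qed (use g[OF that] in auto)
    then show "t \<in> {t \<in> T. g t = s} \<longleftrightarrow>
        t \<in> {(r, i) \<in> R \<times> (UNIV :: bool set). (if i then u else 1) * r\<^sup>2 - s \<in> ideal_pow 1}"
      by (auto simp: T_def c_def)
  qed
  have "(\<Sum>r\<in>R. h (r\<^sup>2)) + (\<Sum>r\<in>R. h (u * r\<^sup>2)) = (\<Sum>r\<in>R. \<Sum>i\<in>UNIV. h (c i * r\<^sup>2))"
    by (simp add: UNIV_bool c_def sum.distrib add.commute)
  also have "\<dots> = (\<Sum>t\<in>T. h (c (snd t) * (fst t)\<^sup>2))"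
    unfolding T_def by (simp add: sum.cartesian_product case_prod_unfold)
  also have "\<dots> = (\<Sum>t\<in>T. h (g t))"
    using h[OF unit] g by (intro sum.cong refl) (auto simp: T_def)
  also have "\<dots> = (\<Sum>s\<in>R. \<Sum>t\<in>{t \<in> T. g t = s}. h (g t))"
    by (rule sum.group[symmetric]) (use fin g in \<open>auto simp: T_def\<close>)
  also have "\<dots> = (\<Sum>s\<in>R. 2 * h s)"
  proof (rule sum.cong[OF refl])
    fix s assume s: "s \<in> R"
    have "(\<Sum>t\<in>{t \<in> T. g t = s}. h (g t)) = of_nat (card {t \<in> T. g t = s}) * h s"
      by simp
    then show "(\<Sum>t\<in>{t \<in> T. g t = s}. h (g t)) = 2 * h s"
      unfolding fibre[OF s] square_fibre_card[OF R u s] by simp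
  qed
  finally show ?thesis by (simp add: sum_distrib_left)
qed

section \<open>Additive characters and Gauss integrals\<close>

text \<open>The condition at 0 excludes the zero function. The notion is stable under rescaling of
  the argument, which is how the characters in the shell integrals arise.\<close>

definition additive_char :: "('k::ab_group_add \<Rightarrow> complex) \<Rightarrow> bool" where
  "additive_char \<psi> \<longleftrightarrow> \<psi> 0 = 1 \<and> (\<forall>x y. \<psi> (x + y) = \<psi> x * \<psi> y)"

lemma additive_char_add: "additive_char \<psi> \<Longrightarrow> \<psi> (x + y) = \<psi> x * \<psi> y"
  by (simp add: additive_char_def)

lemma additive_char_zero: "additive_char \<psi> \<Longrightarrow> \<psi> 0 = 1"
  by (simp add: additive_char_def)

lemma additive_char_cong:
  assumes "additive_char \<psi>" "\<psi> (x - y) = 1"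
  shows "\<psi> x = \<psi> y"
  using additive_char_add[OF assms(1), of "x - y" y] assms(2) by simp

lemma additive_char_scale:
  fixes \<psi> :: "'k::ring \<Rightarrow> complex"
  assumes "additive_char \<psi>"
  shows "additive_char (\<lambda>x. \<psi> (a * x))"
  using assms by (simp add: additive_char_def distrib_left)

text \<open>The exponent d is the last ideal on which \<psi> is non-trivial, not the first on which
  it is trivial, so that some element of order exactly d has a value other than 1.\<close>

definition conductor_exponent :: "('k::discretely_valued_field \<Rightarrow> complex) \<Rightarrow> int \<Rightarrow> bool" where
  "conductor_exponent \<psi> d \<longleftrightarrow> (\<forall>x\<in>ideal_pow (d + 1). \<psi> x = 1) \<and> (\<exists>x\<in>ideal_pow d. \<psi> x \<noteq> 1)"

lemma conductor_exponent_scale: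
  assumes "conductor_exponent \<psi> d" "a \<noteq> 0"
  shows "conductor_exponent (\<lambda>x. \<psi> (a * x)) (d - ord a)"
proof -
  obtain y where y: "y \<in> ideal_pow d" "\<psi> y \<noteq> 1" using assms by (auto simp: conductor_exponent_def)
  have "\<psi> (a * x) = 1" if "x \<in> ideal_pow (d - ord a + 1)" for x
  proof -
    have "a * x \<in> ideal_pow (d + 1)"
      by (rule ideal_pow_mult[OF _ that, of _ "ord a"]) (auto simp: ideal_pow_def)
    then show ?thesis using assms by (simp add: conductor_exponent_def)
  qed
  moreover have "inverse a * y \<in> ideal_pow (d - ord a)"
    by (rule ideal_pow_mult[OF _ y(1), of _ "- ord a"]) (use assms in \<open>auto simp: ideal_pow_def ord_inverse\<close>)
  moreover have "\<psi> (a * (inverse a * y)) \<noteq> 1" using y assms by (simp flip: mult.assoc)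
  ultimately show ?thesis unfolding conductor_exponent_def by blast
qed

lemma conductor_exponent_witness:
  assumes \<psi>: "additive_char \<psi>" "conductor_exponent \<psi> d"
  obtains y where "y \<noteq> 0" "ord y = d" "\<psi> y \<noteq> 1"
proof -
  obtain y where y: "y \<in> ideal_pow d" "\<psi> y \<noteq> 1" using \<psi> by (auto simp: conductor_exponent_def)
  then have "y \<notin> ideal_pow (d + 1)" using \<psi> by (auto simp: conductor_exponent_def)
  then have "y \<noteq> 0 \<and> ord y = d" using y(1) by (auto simp: ideal_pow_def)
  then show thesis using that y(2) by blast
qed

text \<open>Translation by a unit y with \<psi>(y) \<noteq> 1 permutes all residue classes and
  multiplies the full sum by \<psi>(y), so that sum is 0; the class of 0 contributes 1.\<close>

lemma character_sum_units:
  fixes \<psi> :: "'k::nonarch_local_field \<Rightarrow> complex"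
  assumes R: "unit_residue_system R" and \<psi>: "additive_char \<psi>" "conductor_exponent \<psi> 0"
  shows "(\<Sum>r\<in>R. \<psi> r) = - 1"
proof -
  note R' = R[unfolded unit_residue_system_def]
  let ?R = "insert 0 R"
  obtain y where y: "y \<noteq> 0" "ord y = 0" "\<psi> y \<noteq> 1" using conductor_exponent_witness[OF \<psi>] by blast
  have triv: "\<psi> x = \<psi> x'" if "x - x' \<in> ideal_pow 1" for x x'
    by (rule additive_char_cong[OF \<psi>(1)]) (use \<psi>(2) that in \<open>simp add: conductor_exponent_def\<close>)
  have R0: "r \<in> ideal_pow 0" if "r \<in> ?R" for r
    using that R' sphere_zero_ideal by auto
  have ex: "\<exists>r\<in>?R. x - r \<in> ideal_pow 1" if "x \<in> ideal_pow 0" for x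
    using R' that by (cases "x \<in> ideal_pow 1") (auto simp: ord_sphere_eq)
  have nz: "r \<notin> ideal_pow 1" if "r \<in> R" for r
    using R' that by (auto simp: ord_sphere_eq)
  have uniq: "r = r'" if "r \<in> ?R" "r' \<in> ?R" "r - r' \<in> ideal_pow 1" for r r'
    using that nz R' ideal_pow_minus_iff[of r' 1] by auto
  define \<rho> where "\<rho> x = (SOME r. r \<in> ?R \<and> x - r \<in> ideal_pow 1)" for x
  have \<rho>: "\<rho> x \<in> ?R \<and> x - \<rho> x \<in> ideal_pow 1" if "x \<in> ideal_pow 0" for x
    unfolding \<rho>_def by (rule someI_ex) (use ex that in blast)
  have O: "r + y \<in> ideal_pow 0" if "r \<in> ?R" for r
    using R0[OF that] y by (intro ideal_pow_add) (auto simp: ideal_pow_def)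
  have "inj_on (\<lambda>r. \<rho> (r + y)) ?R"
  proof (rule inj_onI)
    fix r r' assume r: "r \<in> ?R" "r' \<in> ?R" "\<rho> (r + y) = \<rho> (r' + y)"
    have "(r + y) - (r' + y) \<in> ideal_pow 1"
      using \<rho>[OF O[OF r(1)]] \<rho>[OF O[OF r(2)]] r(3) ideal_pow_trans ideal_pow_diff_commute by metis
    then show "r = r'" using uniq r by simp
  qed
  moreover have "(\<lambda>r. \<rho> (r + y)) ` ?R \<subseteq> ?R" using \<rho> O by blast
  ultimately have bij: "bij_betw (\<lambda>r. \<rho> (r + y)) ?R ?R"
    using R' by (intro bij_betw_imageI endo_inj_surj) auto
  have "(\<Sum>r\<in>?R. \<psi> r) = (\<Sum>r\<in>?R. \<psi> (\<rho> (r + y)))"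
    using sum.reindex_bij_betw[OF bij, of \<psi>] by simp
  also have "\<dots> = (\<Sum>r\<in>?R. \<psi> r * \<psi> y)"
    using triv \<rho>[OF O] additive_char_add[OF \<psi>(1)] by (intro sum.cong refl) metis
  also have "\<dots> = (\<Sum>r\<in>?R. \<psi> r) * \<psi> y" by (rule sum_distrib_right[symmetric])
  finally have "(\<Sum>r\<in>?R. \<psi> r) = (\<Sum>r\<in>?R. \<psi> r) * \<psi> y" .
  then have "(\<Sum>r\<in>?R. \<psi> r) = 0" using y(3) by simp
  moreover have "0 \<notin> R" using R' by (auto simp: ord_sphere_def)
  ultimately show ?thesis
    using R' additive_char_zero[OF \<psi>(1)] by (simp add: add_eq_0_iff)
qed

section \<open>Masses of points, shells and residue cosets\<close>

lemma haar_finite: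
  assumes \<mu>: "normalized_haar (\<mu> :: 'k::nonarch_local_field measure)" and "A \<subseteq> ideal_pow 0"
  shows "emeasure \<mu> A \<noteq> \<infinity>"
proof -
  have "emeasure \<mu> A \<le> emeasure \<mu> (ideal_pow 0)"
    using normalized_haarD(1)[OF \<mu>] by (intro emeasure_mono assms) auto
  then show ?thesis using normalized_haarD(4)[OF \<mu>] by (auto simp: top_unique)
qed

text \<open>All points have the same mass by translation, and the integer ring, of mass 1, contains
  infinitely many distinct powers of an element of order 1.\<close>

lemma haar_zero:
  assumes \<mu>: "normalized_haar (\<mu> :: 'k::nonarch_local_field measure)"
  shows "measure \<mu> {0} = 0"
proof (rule ccontr)
  assume nz: "measure \<mu> {0} \<noteq> 0"
  note h = normalized_haarD[OF \<mu>]
  have sing: "measure \<mu> {a} = measure \<mu> {0}" for a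
  proof -
    have m: "(\<lambda>x. a + x) \<in> \<mu> \<rightarrow>\<^sub>M borel"
      using borel_measurable_isometry[of "\<lambda>x. a + x"] h(1) measurable_cong_sets
      by (force simp: dist_norm_val)
    have "measure \<mu> {a} = measure (distr \<mu> borel (\<lambda>x. a + x)) {a}" using h(3) by simp
    also have "\<dots> = measure \<mu> ((\<lambda>x. a + x) -` {a} \<inter> space \<mu>)"
      by (rule measure_distr[OF m]) simp
    also have "(\<lambda>x. a + x) -` {a} \<inter> space \<mu> = {0}" using h(2) by auto
    finally show ?thesis .
  qed
  obtain p :: 'k where p: "p \<noteq> 0" "ord p = 1" using ord_surj by blast
  have ordp: "ord (p ^ n) = int n" for n
    by (induction n) (use p in \<open>auto simp: ord_mult\<close>)
  have inj: "inj (\<lambda>n. p ^ n)" by (rule injI) (metis ordp of_nat_eq_iff)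
  obtain N :: nat where N: "1 / measure \<mu> {0} < N" using reals_Archimedean2 by blast
  let ?A = "(\<lambda>n. p ^ n) ` {..<N}"
  have sub: "?A \<subseteq> ideal_pow 0" using ordp by (auto simp: ideal_pow_def)
  have "measure \<mu> ?A = (\<Sum>a\<in>?A. measure \<mu> {a})"
    by (rule measure_eq_sum_singleton) (use haar_finite[OF \<mu> sub] haar_finite[OF \<mu>] sub h(1) in auto)
  also have "\<dots> = (\<Sum>a\<in>?A. measure \<mu> {0})" by (rule sum.cong[OF refl sing])
  also have "\<dots> = N * measure \<mu> {0}"
    using card_image[OF inj_on_subset[OF inj subset_UNIV], of "{..<N}"] by simp
  also have "\<dots> > 1" using N nz by (simp add: divide_less_eq zero_less_measure_iff)
  finally have "1 < measure \<mu> ?A" .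
  moreover have "emeasure \<mu> ?A \<le> 1"
    using emeasure_mono[OF sub, of \<mu>] h(1,4) by simp
  then have "measure \<mu> ?A \<le> 1"
    unfolding measure_def using enn2real_mono[of _ 1] by simp
  ultimately show False by simp
qed

text \<open>The shells exhaust p only up to the null set {0}. The sum is the contribution of the
  shells on which the character in a Gauss integral is already trivial.\<close>

lemma haar_shells_sum:
  assumes \<mu>: "normalized_haar (\<mu> :: 'k::nonarch_local_field measure)"
  shows "((\<lambda>l. measure \<mu> (ord_sphere l)) has_sum measure \<mu> (ideal_pow 1)) {1..}"
proof -
  note h = normalized_haarD[OF \<mu>]
  let ?F = "\<lambda>n. ord_sphere (int n + 1) :: 'k set"
  have U: "(\<Union>n. ?F n) = ideal_pow 1 - {0}"
  proof
    show "ideal_pow 1 - {0} \<subseteq> (\<Union>n. ?F n)"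
    proof
      fix x :: 'k assume "x \<in> ideal_pow 1 - {0}"
      then have "x \<in> ?F (nat (ord x - 1))" by (auto simp: ord_sphere_def ideal_pow_def)
      then show "x \<in> (\<Union>n. ?F n)" by blast
    qed
  qed (auto simp: ord_sphere_def ideal_pow_def)
  have sub: "ideal_pow 1 - {0} \<subseteq> (ideal_pow 0 :: 'k set)" by (auto simp: ideal_pow_def)
  have "(\<lambda>n. measure \<mu> (?F n)) sums measure \<mu> (\<Union>n. ?F n)"
  proof (rule measure_UNION)
    show "disjoint_family ?F" by (auto simp: disjoint_family_on_def ord_sphere_def)
    show "emeasure \<mu> (\<Union>n. ?F n) \<noteq> \<infinity>" unfolding U by (rule haar_finite[OF \<mu> sub])
    show "range ?F \<subseteq> sets \<mu>" unfolding h(1) by (intro image_subsetI ord_sphere_borel)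
  qed
  moreover have "measure \<mu> (ideal_pow 1 - {0}) = measure \<mu> (ideal_pow 1)"
  proof (rule measure_Diff_null_set)
    have "{0} \<subseteq> (ideal_pow 0 :: 'k set)" by simp
    then have "emeasure \<mu> {0} = 0"
      using haar_zero[OF \<mu>] haar_finite[OF \<mu>] by (simp add: measure_def enn2real_eq_0_iff)
    then show "{0} \<in> null_sets \<mu>" by (simp add: null_sets_def h(1))
  qed (simp add: h(1))
  ultimately have "((\<lambda>n. measure \<mu> (?F n)) has_sum measure \<mu> (ideal_pow 1)) UNIV"
    by (intro sums_nonneg_imp_has_sum) (auto simp: U)
  moreover have "inj (\<lambda>n. int n + 1)" by (simp add: inj_def)
  moreover have "range (\<lambda>n. int n + 1) = {1..}"
  proof
    show "{1..} \<subseteq> range (\<lambda>n. int n + 1)"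
      by (auto intro!: image_eqI[of _ _ "nat (_ - 1)"])
  qed auto
  ultimately show ?thesis
    using has_sum_reindex[of "\<lambda>n. int n + 1" UNIV "\<lambda>l. measure \<mu> (ord_sphere l)" "measure \<mu> (ideal_pow 1)"]
    by (simp add: o_def)
qed

lemma unit_shell_integral:
  fixes h :: "'k::nonarch_local_field \<Rightarrow> complex"
  assumes \<mu>: "normalized_haar \<mu>" and R: "unit_residue_system R"
    and h: "\<And>x y. x \<in> ord_sphere 0 \<Longrightarrow> x - y \<in> ideal_pow 1 \<Longrightarrow> h x = h y"
  shows "(LINT x:ord_sphere 0|\<mu>. h x) = measure \<mu> (ideal_pow 1) * (\<Sum>r\<in>R. h r)"
proof -
  note R' = R[unfolded unit_residue_system_def]
  have fin: "finite R" using R' by blast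
  let ?C = "\<lambda>r. {x. x - r \<in> ideal_pow 1}"
  have eq: "indicator (ord_sphere 0) x *\<^sub>R h x = (\<Sum>r\<in>R. indicator (?C r) x *\<^sub>R h r)" for x
  proof (cases "x \<in> ord_sphere 0")
    case True
    then obtain r where r: "r \<in> R" "x - r \<in> ideal_pow 1" using R' by blast
    have "(\<Sum>r\<in>R. indicator (?C r) x *\<^sub>R h r) = (\<Sum>r'\<in>R. if r' = r then h r else 0)"
    proof (rule sum.cong[OF refl])
      fix r' assume r': "r' \<in> R"
      have "x - r' \<in> ideal_pow 1 \<longleftrightarrow> r' = r"
        using R' r r' ideal_pow_trans ideal_pow_diff_commute by blast
      then show "indicator (?C r') x *\<^sub>R h r' = (if r' = r then h r else 0)" by auto
    qed
    also have "\<dots> = h r" using fin r by simp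
    finally show ?thesis using True h[OF True r(2)] by simp
  next
    case False
    have "x - r \<notin> ideal_pow 1" if "r \<in> R" for r
      using ord_cong[of r x] R' that False by (auto simp: ord_sphere_def)
    then show ?thesis using False by (simp add: sum.neutral)
  qed
  have fin_C: "emeasure \<mu> (?C r) < \<infinity>" for r
    using haar_coset[OF \<mu>, of r 1] haar_finite[OF \<mu>, of "ideal_pow 1"]
    by (simp add: ideal_pow_def top.not_eq_extremum subset_iff)
  have C: "?C r \<in> sets \<mu>" for r using normalized_haarD(1)[OF \<mu>] by simp
  have meas: "measure \<mu> (?C r) = measure \<mu> (ideal_pow 1)" for r
    using haar_coset[OF \<mu>, of r 1] by (simp add: measure_def)
  have "(LINT x:ord_sphere 0|\<mu>. h x) = (LINT x|\<mu>. (\<Sum>r\<in>R. indicator (?C r) x *\<^sub>R h r))"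
    unfolding set_lebesgue_integral_def eq ..
  also have "\<dots> = (\<Sum>r\<in>R. LINT x|\<mu>. indicator (?C r) x *\<^sub>R h r)"
    using C fin_C by (intro Bochner_Integration.integral_sum integrable_scaleR_left integrable_real_indicator) auto
  also have "\<dots> = (\<Sum>r\<in>R. measure \<mu> (ideal_pow 1) * h r)"
    using C fin_C meas normalized_haarD(2)[OF \<mu>]
    by (intro sum.cong refl)
      (subst integral_scaleR_left, auto simp: scaleR_conv_of_real intro!: integrable_real_indicator)
  finally show ?thesis by (simp add: sum_distrib_left)
qed

text \<open>This is the integral of \<psi>(t^2) over the field, summed over shells in the same way
  as the inner sum of \<open>mock_fourier\<close>.\<close>

definition gauss_integral ::
    "'k::nonarch_local_field measure \<Rightarrow> ('k \<Rightarrow> complex) \<Rightarrow> complex" where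
  "gauss_integral \<mu> \<psi> = (\<Sum>\<^sub>\<infinity>l\<in>(UNIV :: int set). LINT t:ord_sphere l|\<mu>. \<psi> (t\<^sup>2))"

text \<open>The equality holds shell by shell, because t \<mapsto> v t is an isometry of each
  shell.\<close>

lemma gauss_integral_square:
  assumes \<mu>: "normalized_haar \<mu>" and v: "v \<in> ord_sphere 0"
  shows "gauss_integral \<mu> (\<lambda>y. \<psi> (v\<^sup>2 * y)) = gauss_integral \<mu> \<psi>"
  unfolding gauss_integral_def
proof (rule infsum_cong)
  fix l :: int
  have v': "v \<noteq> 0" "ord v = 0" using v by (auto simp: ord_sphere_def)
  have "bij_betw (\<lambda>t. v * t) (ord_sphere l) (ord_sphere l)"
    by (rule bij_betw_byWitness[where f' = "\<lambda>t. t / v"])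
      (use v' in \<open>auto simp: ord_sphere_def ord_mult ord_divide\<close>)
  moreover have "dist (v * x) (v * y) = dist x y" for x y
    using v' by (intro dist_eqI) (auto simp: ord_mult simp flip: right_diff_distrib)
  ultimately have "(LINT t:ord_sphere l|\<mu>. \<psi> ((v * t)\<^sup>2)) = (LINT t:ord_sphere l|\<mu>. \<psi> (t\<^sup>2))"
    by (rule shell_integral_isometry[OF \<mu>, where f = "\<lambda>t. \<psi> (t\<^sup>2)"])
  then show "(LINT t:ord_sphere l|\<mu>. \<psi> (v\<^sup>2 * t\<^sup>2)) = (LINT t:ord_sphere l|\<mu>. \<psi> (t\<^sup>2))"
    by (simp add: power_mult_distrib)
qed

lemma gauss_shell_negative:
  fixes \<psi> :: "'k::nonarch_local_field \<Rightarrow> complex"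
  assumes two: "(2::'k) \<notin> max_ideal" and \<mu>: "normalized_haar \<mu>"
    and \<psi>: "additive_char \<psi>" "conductor_exponent \<psi> 0" and "l < 0"
  shows "(LINT t:ord_sphere l|\<mu>. \<psi> (t\<^sup>2)) = 0"
proof -
  obtain y where y: "y \<noteq> 0" "ord y = 0" "\<psi> y \<noteq> 1" using conductor_exponent_witness[OF \<psi>] by blast
  note two' = ord_two[OF two]
  show ?thesis
  proof (rule shell_integral_local_scaling[OF \<mu> y(3)])
    fix t0 :: 'k assume "t0 \<in> ord_sphere l"
    then have t0: "t0 \<noteq> 0" "ord t0 = l" by (auto simp: ord_sphere_def)
    \<comment> \<open>The factor 1 + u adds 2 u t^2 + u^2 t^2 to t^2. With this u the first term is
      y modulo p, and the second has order at least -2 l > 0.\<close>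
    define u where "u = y / (2 * t0\<^sup>2)"
    have u: "u \<in> ideal_pow (- 2 * l)"
      using y two' t0 by (simp add: u_def ideal_pow_def ord_divide ord_mult ord_power2)
    have "\<psi> ((t * (1 + u))\<^sup>2) = \<psi> y * \<psi> (t\<^sup>2)" if t: "t - t0 \<in> ideal_pow (l + 1)" for t
    proof -
      have tl: "t \<in> ideal_pow l" "t0 \<in> ideal_pow l"
        using ord_cong[of t0 t] t t0 by (auto simp: ideal_pow_def)
      have "(t - t0) * (t + t0) \<in> ideal_pow (2 * l + 1)"
        by (rule ideal_pow_mult[OF t ideal_pow_add[OF tl]]) simp
      moreover have "2 * u \<in> ideal_pow (- 2 * l)"
        by (rule ideal_pow_mult[OF _ u, of _ 0]) (auto simp: ideal_pow_def two')
      ultimately have "(t - t0) * (t + t0) * (2 * u) \<in> ideal_pow 1"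
        by (rule ideal_pow_mult) simp
      moreover have tu: "t * u \<in> ideal_pow (- l)" by (rule ideal_pow_mult[OF tl(1) u]) simp
      have "(t * u) * (t * u) \<in> ideal_pow 1"
        by (rule ideal_pow_mult[OF tu tu]) (use \<open>l < 0\<close> in simp)
      then have "t\<^sup>2 * u\<^sup>2 \<in> ideal_pow 1"
        by (simp add: power_mult_distrib flip: power2_eq_square)
      ultimately have "(t - t0) * (t + t0) * (2 * u) + t\<^sup>2 * u\<^sup>2 \<in> ideal_pow 1"
        by (rule ideal_pow_add)
      moreover have "(t * (1 + u))\<^sup>2 - (y + t\<^sup>2) = (t - t0) * (t + t0) * (2 * u) + t\<^sup>2 * u\<^sup>2"
      proof -
        have "y = 2 * u * t0\<^sup>2" using t0 two' by (simp add: u_def)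
        then show ?thesis by (simp add: power2_eq_square algebra_simps)
      qed
      ultimately have "\<psi> ((t * (1 + u))\<^sup>2) = \<psi> (y + t\<^sup>2)"
        using \<psi>(2) by (intro additive_char_cong[OF \<psi>(1)]) (simp add: conductor_exponent_def)
      then show ?thesis using additive_char_add[OF \<psi>(1)] by simp
    qed
    moreover have "u \<in> ideal_pow 1" by (rule ideal_pow_mono[OF _ u]) (use \<open>l < 0\<close> in simp)
    ultimately show "\<exists>u\<in>ideal_pow 1. \<forall>t. t - t0 \<in> ideal_pow (l + 1) \<longrightarrow>
        \<psi> ((t * (1 + u))\<^sup>2) = \<psi> y * \<psi> (t\<^sup>2)" by blast
  qed
qed

text \<open>Negative shells vanish and the unit shell gives the sum over non-zero residues. The
  summand 1 is the zero residue class, that is, all positive shells together.\<close>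

lemma gauss_integral_eval:
  fixes \<psi> :: "'k::nonarch_local_field \<Rightarrow> complex"
  assumes two: "(2::'k) \<notin> max_ideal" and \<mu>: "normalized_haar \<mu>" and R: "unit_residue_system R"
    and \<psi>: "additive_char \<psi>" "conductor_exponent \<psi> 0"
  shows "gauss_integral \<mu> \<psi> = measure \<mu> (ideal_pow 1) * (1 + (\<Sum>r\<in>R. \<psi> (r\<^sup>2)))"
proof -
  let ?J = "\<lambda>l. LINT t:ord_sphere l|\<mu>. \<psi> (t\<^sup>2)"
  have pos: "?J l = of_real (measure \<mu> (ord_sphere l))" if "1 \<le> l" for l
  proof -
    have "\<psi> (t\<^sup>2) = 1" if "t \<in> ord_sphere l" for t
      using \<psi>(2) \<open>1 \<le> l\<close> that by (auto simp: conductor_exponent_def ord_sphere_def ideal_pow_def ord_power2)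
    then have "?J l = (LINT t:ord_sphere l|\<mu>. 1)" by (rule shell_integral_cong[OF \<mu>])
    also have "\<dots> = of_real (measure \<mu> (ord_sphere l))"
    proof -
      have "ord_sphere l \<subseteq> (ideal_pow 0 :: 'k set)"
        using \<open>1 \<le> l\<close> by (auto simp: ord_sphere_def ideal_pow_def)
      then show ?thesis
        using haar_finite[OF \<mu>] normalized_haarD(1)[OF \<mu>]
        by (subst set_integral_const) (simp_all add: scaleR_conv_of_real)
    qed
    finally show ?thesis .
  qed
  have "?J 0 = measure \<mu> (ideal_pow 1) * (\<Sum>r\<in>R. \<psi> (r\<^sup>2))"
  proof (rule unit_shell_integral[OF \<mu> R])
    fix x y :: 'k assume x: "x \<in> ord_sphere 0" and xy: "x - y \<in> ideal_pow 1"
    have x0: "x \<in> ideal_pow 0" using x sphere_zero_ideal by blast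
    have y0: "y \<in> ideal_pow 0"
      using ideal_pow_diff[OF x0 ideal_pow_mono[OF _ xy, of 0]] by simp
    have "(x - y) * (x + y) \<in> ideal_pow 1"
      by (rule ideal_pow_mult[OF xy ideal_pow_add[OF x0 y0]]) simp
    then have "x\<^sup>2 - y\<^sup>2 \<in> ideal_pow 1" by (simp add: power2_eq_square algebra_simps)
    then show "\<psi> (x\<^sup>2) = \<psi> (y\<^sup>2)"
      using \<psi>(2) by (intro additive_char_cong[OF \<psi>(1)]) (simp add: conductor_exponent_def)
  qed
  moreover have "((\<lambda>l. complex_of_real (measure \<mu> (ord_sphere l))) has_sum measure \<mu> (ideal_pow 1)) {1..}"
    using haar_shells_sum[OF \<mu>] by (simp add: has_sum_of_real_iff)
  then have "(?J has_sum measure \<mu> (ideal_pow 1)) {1..}"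
    by (rule has_sum_cong[THEN iffD1, rotated]) (simp add: pos)
  moreover have "(?J has_sum ?J 0) {0}" by (simp add: has_sum_finiteI)
  ultimately have "(?J has_sum (measure \<mu> (ideal_pow 1) * (\<Sum>r\<in>R. \<psi> (r\<^sup>2)) + measure \<mu> (ideal_pow 1)))
      ({0} \<union> {1..})"
    by (intro has_sum_Un_disjoint) auto
  also have "?this \<longleftrightarrow>
      (?J has_sum (measure \<mu> (ideal_pow 1) * (\<Sum>r\<in>R. \<psi> (r\<^sup>2)) + measure \<mu> (ideal_pow 1))) UNIV"
    by (rule has_sum_cong_neutral) (use gauss_shell_negative[OF two \<mu> \<psi>] in auto)
  finally show ?thesis
    unfolding gauss_integral_def by (simp add: infsumI algebra_simps)
qed

text \<open>The character sums over r^2 and over u r^2 add up to twice the sum over the units, which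
  is -2. This exactly offsets the two summands 1 in the evaluation, so the two integrals are
  opposite.\<close>

lemma gauss_integral_nonsquare:
  fixes \<psi> :: "'k::nonarch_local_field \<Rightarrow> complex"
  assumes two: "(2::'k) \<notin> max_ideal" and \<mu>: "normalized_haar \<mu>"
    and \<psi>: "additive_char \<psi>" "conductor_exponent \<psi> 0" and u: "nonsquare_unit u"
  shows "gauss_integral \<mu> (\<lambda>y. \<psi> (u * y)) = - gauss_integral \<mu> \<psi>"
proof -
  obtain R :: "'k set" where R: "unit_residue_system R" using unit_residue_system_exists by blast
  have u': "u \<noteq> 0" "ord u = 0" using u by (auto simp: nonsquare_unit_def)
  have "(\<Sum>r\<in>R. \<psi> (r\<^sup>2)) + (\<Sum>r\<in>R. \<psi> (u * r\<^sup>2)) = 2 * (\<Sum>r\<in>R. \<psi> r)"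
    by (rule sum_over_squares[OF R u])
      (use \<psi>(2) in \<open>intro additive_char_cong[OF \<psi>(1)], simp add: conductor_exponent_def\<close>)
  then have S: "(\<Sum>r\<in>R. \<psi> (u * r\<^sup>2)) = - 2 - (\<Sum>r\<in>R. \<psi> (r\<^sup>2))"
    using character_sum_units[OF R \<psi>] by (simp add: algebra_simps)
  have "conductor_exponent (\<lambda>y. \<psi> (u * y)) 0"
    using conductor_exponent_scale[OF \<psi>(2) u'(1)] u'(2) by simp
  then have "gauss_integral \<mu> (\<lambda>y. \<psi> (u * y)) =
      measure \<mu> (ideal_pow 1) * (1 + (- 2 - (\<Sum>r\<in>R. \<psi> (r\<^sup>2))))"
    unfolding S[symmetric] by (rule gauss_integral_eval[OF two \<mu> R additive_char_scale[OF \<psi>(1)]])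
  then show ?thesis
    unfolding gauss_integral_eval[OF two \<mu> R \<psi>] by (simp add: algebra_simps)
qed

section \<open>Continuity yields a conductor\<close>

lemma nontrivial_additive_characterD:
  assumes "nontrivial_additive_character \<Phi>"
  shows "additive_char \<Phi>" "cmod (\<Phi> x) = 1"
proof -
  have "cmod (\<Phi> 0) = 1" "\<Phi> (0 + 0) = \<Phi> 0 * \<Phi> 0"
    using assms unfolding nontrivial_additive_character_def by blast+
  then have "\<Phi> 0 = 1" by auto
  then show "additive_char \<Phi>"
    using assms by (simp add: additive_char_def nontrivial_additive_character_def)
  show "cmod (\<Phi> x) = 1" using assms by (simp add: nontrivial_additive_character_def)
qed

text \<open>A subgroup of the unit circle inside the disc \<open>\<bar>z - 1\<bar> < 1\<close> is trivial: squaring at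
  least triples \<open>1 - Re z\<close> there.\<close>

lemma additive_char_trivial_on_ideal:
  assumes \<Phi>: "nontrivial_additive_character \<Phi>"
    and small: "\<And>y. y \<in> ideal_pow n \<Longrightarrow> cmod (\<Phi> y - 1) < 1" and x: "x \<in> ideal_pow n"
  shows "\<Phi> x = 1"
proof -
  note D = nontrivial_additive_characterD[OF \<Phi>]
  have sq: "(Re (\<Phi> y))\<^sup>2 + (Im (\<Phi> y))\<^sup>2 = 1" for y
    using D(2)[of y] by (simp add: cmod_def)
  have half: "1 - Re (\<Phi> y) < 1 / 2" if "y \<in> ideal_pow n" for y
  proof -
    have "(cmod (\<Phi> y - 1))\<^sup>2 < 1"
      using small[OF that] by (simp add: power_less_one_iff)
    then have "(Re (\<Phi> y) - 1)\<^sup>2 + (Im (\<Phi> y))\<^sup>2 < 1" unfolding cmod_power2 by simp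
    then show ?thesis using sq[of y] by (simp add: power2_eq_square algebra_simps)
  qed
  \<comment> \<open>For |z| = 1 one has 1 - Re (z^2) = 2 (1 - Re z) (1 + Re z), and Re z > 1/2 makes
    2 (1 + Re z) at least 3.\<close>
  have double: "3 * (1 - Re (\<Phi> y)) \<le> 1 - Re (\<Phi> (y + y))" if "y \<in> ideal_pow n" for y
  proof -
    have "1 - Re (\<Phi> (y + y)) = 2 * (1 - Re (\<Phi> y)) * (1 + Re (\<Phi> y))"
      using sq[of y] unfolding additive_char_add[OF D(1)]
      by (simp add: power2_eq_square algebra_simps)
    moreover have "Re (\<Phi> y) \<le> 1" using D(2)[of y] complex_Re_le_cmod[of "\<Phi> y"] by simp
    then have "(1 - Re (\<Phi> y)) * 3 \<le> (1 - Re (\<Phi> y)) * (2 * (1 + Re (\<Phi> y)))"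
      using half[OF that] by (intro mult_left_mono) auto
    ultimately show ?thesis by (simp add: algebra_simps)
  qed
  have bound: "3 ^ k * (1 - Re (\<Phi> y)) \<le> 1 / 2" if "y \<in> ideal_pow n" for k y
    using that
  proof (induction k arbitrary: y)
    case 0
    then show ?case using half[of y] by simp
  next
    case (Suc k)
    have "3 ^ Suc k * (1 - Re (\<Phi> y)) = 3 ^ k * (3 * (1 - Re (\<Phi> y)))" by simp
    also have "\<dots> \<le> 3 ^ k * (1 - Re (\<Phi> (y + y)))" using double[OF Suc.prems] by simp
    also have "\<dots> \<le> 1 / 2" by (rule Suc.IH[OF ideal_pow_add[OF Suc.prems Suc.prems]])
    finally show ?case .
  qed
  have "1 - Re (\<Phi> x) \<le> 0"
  proof (rule ccontr)
    assume "\<not> 1 - Re (\<Phi> x) \<le> 0"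
    then obtain k where "1 / (1 - Re (\<Phi> x)) < 3 ^ k"
      using real_arch_pow[of 3] by auto
    then have "1 < 3 ^ k * (1 - Re (\<Phi> x))"
      using \<open>\<not> 1 - Re (\<Phi> x) \<le> 0\<close> by (simp add: field_simps)
    then show False using bound[OF x, of k] by simp
  qed
  moreover have "Re (\<Phi> x) \<le> 1" using D(2)[of x] complex_Re_le_cmod[of "\<Phi> x"] by simp
  ultimately have "Re (\<Phi> x) = 1" by simp
  moreover have "Im (\<Phi> x) = 0" using sq[of x] \<open>Re (\<Phi> x) = 1\<close> by simp
  ultimately show ?thesis by (simp add: complex_eq_iff)
qed

text \<open>Continuity at 0 puts the image of some p^N into a disc that contains no non-trivial
  subgroup. Enlarging p^N one step at a time, the first ideal with a non-trivial value gives the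
  exponent.\<close>

lemma conductor_exponent_exists:
  fixes \<Phi> :: "'k::nonarch_local_field \<Rightarrow> complex"
  assumes \<Phi>: "nontrivial_additive_character \<Phi>"
  obtains d where "conductor_exponent \<Phi> d"
proof -
  note D = nontrivial_additive_characterD[OF \<Phi>]
  have "open (\<Phi> -` ball 1 1)"
    using \<Phi> by (intro open_vimage) (auto simp: nontrivial_additive_character_def)
  moreover have "0 \<in> \<Phi> -` ball 1 1" by (simp add: additive_char_zero[OF D(1)])
  ultimately obtain N where N: "{x. x - 0 \<in> ideal_pow N} \<subseteq> \<Phi> -` ball 1 1"
    using open_contains_coset by blast
  have N: "\<Phi> x = 1" if "x \<in> ideal_pow N" for x
    by (rule additive_char_trivial_on_ideal[OF \<Phi> _ that]) (use N in \<open>auto simp: dist_norm norm_minus_commute\<close>)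
  obtain x where x: "\<Phi> x \<noteq> 1" using \<Phi> by (auto simp: nontrivial_additive_character_def)
  have "x \<noteq> 0" using x additive_char_zero[OF D(1)] by auto
  let ?P = "\<lambda>k::nat. \<exists>x\<in>ideal_pow (N - int k). \<Phi> x \<noteq> 1"
  have "?P (nat (N - ord x))" using x by (intro bexI[of _ x]) (auto simp: ideal_pow_def)
  then have ex: "?P (LEAST k. ?P k)" by (rule LeastI)
  define k where "k = (LEAST k. ?P k)"
  have "k \<noteq> 0" using ex N unfolding k_def[symmetric] by (metis diff_zero of_nat_0)
  then have "\<not> ?P (k - 1)" using not_less_Least[of "k - 1" ?P] unfolding k_def[symmetric] by simp
  moreover have k: "N - int (k - 1) = N - int k + 1" using \<open>k \<noteq> 0\<close> by simp
  ultimately have "\<forall>x\<in>ideal_pow (N - int k + 1). \<Phi> x = 1" unfolding k by blast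
  then have "conductor_exponent \<Phi> (N - int k)"
    using ex unfolding conductor_exponent_def k_def[symmetric] by blast
  then show thesis using that by blast
qed

section \<open>Norms from quadratic algebras\<close>

lemma quad_norm_mult: "quad_norm \<theta> (quad_mult \<theta> u v) = quad_norm \<theta> u * quad_norm \<theta> v"
  by (simp add: quad_norm_def quad_mult_def power2_eq_square algebra_simps)

text \<open>An element is invertible iff its norm is non-zero, the inverse being the conjugate
  divided by the norm. This covers the split algebra as well, where non-zero elements may have norm
  0.\<close>

lemma quad_norm_image_iff:
  "x \<in> quad_norm \<theta> ` quad_units \<theta> \<longleftrightarrow> x \<noteq> 0 \<and> (\<exists>a b. x = a\<^sup>2 - b\<^sup>2 * \<theta>)"
proof
  assume "x \<in> quad_norm \<theta> ` quad_units \<theta>"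
  then obtain u v where u: "x = quad_norm \<theta> u" "quad_mult \<theta> u v = (1, 0)"
    by (auto simp: quad_units_def)
  have "quad_norm \<theta> u * quad_norm \<theta> v = 1"
    using quad_norm_mult[of \<theta> u v] u(2) by (simp add: quad_norm_def)
  then show "x \<noteq> 0 \<and> (\<exists>a b. x = a\<^sup>2 - b\<^sup>2 * \<theta>)" using u(1) by (auto simp: quad_norm_def)
next
  assume "x \<noteq> 0 \<and> (\<exists>a b. x = a\<^sup>2 - b\<^sup>2 * \<theta>)"
  then obtain a b where x: "x \<noteq> 0" "x = a\<^sup>2 - b\<^sup>2 * \<theta>" by blast
  have "quad_mult \<theta> (a, b) (a / x, - b / x) = ((a\<^sup>2 - b\<^sup>2 * \<theta>) / x, 0)"
    using x(1) by (simp add: quad_mult_def power2_eq_square diff_divide_distrib mult.commute)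
  then have "(a, b) \<in> quad_units \<theta>" using x by (auto simp: quad_units_def)
  then show "x \<in> quad_norm \<theta> ` quad_units \<theta>" using x(2)
    by (intro image_eqI[of _ _ "(a, b)"]) (simp_all add: quad_norm_def)
qed

text \<open>The form is (a - b) (a + b); the witnesses solve a + b = x and a - b = 1.\<close>

lemma norm_split:
  fixes x :: "'k::field"
  assumes "(2::'k) \<noteq> 0"
  obtains a b where "x = a\<^sup>2 - b\<^sup>2 * 1"
proof -
  have four: "(2::'k)\<^sup>2 \<noteq> 0" using assms by (rule power_not_zero)
  have "((x + 1) / 2)\<^sup>2 - ((x - 1) / 2)\<^sup>2 * 1 = ((x + 1)\<^sup>2 - (x - 1)\<^sup>2) / 2\<^sup>2"
    unfolding power_divide mult_1_right by (rule diff_divide_distrib[symmetric])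
  also have "(x + 1)\<^sup>2 - (x - 1)\<^sup>2 = x * 2\<^sup>2" by (simp add: power2_eq_square algebra_simps)
  finally show thesis using that four by (metis nonzero_mult_div_cancel_right)
qed

text \<open>If a / b is integral, the norm is b^2 times (a / b)^2 - \<epsilon>, a unit because
  \<epsilon> is not a square modulo p. Otherwise a^2 dominates.\<close>

lemma even_ord_unramified_norm:
  assumes \<epsilon>: "nonsquare_unit \<epsilon>" and "a\<^sup>2 - b\<^sup>2 * \<epsilon> \<noteq> 0"
  shows "even (ord (a\<^sup>2 - b\<^sup>2 * \<epsilon>))"
proof (cases "b = 0 \<or> a / b \<notin> ideal_pow 0")
  case False
  then have ab: "b \<noteq> 0" "a / b \<in> ideal_pow 0" by auto
  have e0: "\<epsilon> \<in> ideal_pow 0" using nonsquare_unitD(1)[OF \<epsilon>] sphere_zero_ideal by blast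
  have "(a / b)\<^sup>2 \<in> ideal_pow 0"
    unfolding power2_eq_square by (rule ideal_pow_mult[OF ab(2) ab(2)]) simp
  then have in0: "(a / b)\<^sup>2 - \<epsilon> \<in> ideal_pow 0" using e0 by (rule ideal_pow_diff)
  moreover have not1: "(a / b)\<^sup>2 - \<epsilon> \<notin> ideal_pow 1"
    using nonsquare_unitD(2)[OF \<epsilon> ab(2)] ideal_pow_diff_commute by blast
  ultimately have o: "(a / b)\<^sup>2 - \<epsilon> \<noteq> 0" "ord ((a / b)\<^sup>2 - \<epsilon>) = 0" by (auto simp: ideal_pow_def)
  have "a\<^sup>2 - b\<^sup>2 * \<epsilon> = b\<^sup>2 * ((a / b)\<^sup>2 - \<epsilon>)"
    using ab(1) by (simp add: power_divide right_diff_distrib)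
  then show ?thesis using o ab(1) by (simp add: ord_mult ord_power2)
next
  case True
  show ?thesis
  proof (cases "b = 0")
    case True
    then show ?thesis using assms(2) by (simp add: ord_power2)
  next
    case False
    have e: "\<epsilon> \<noteq> 0" "ord \<epsilon> = 0" using \<epsilon> by (auto simp: nonsquare_unit_def)
    have "a / b \<notin> ideal_pow 0" using True False by simp
    then have a: "a \<noteq> 0" "ord a < ord b" using False by (auto simp: ideal_pow_def ord_divide)
    then have "a\<^sup>2 + - (b\<^sup>2 * \<epsilon>) \<noteq> 0 \<and> ord (a\<^sup>2 + - (b\<^sup>2 * \<epsilon>)) = ord (a\<^sup>2)"
      using e False by (intro conjI ord_add_dominant) (auto simp: ideal_pow_def ord_mult ord_power2)
    then show ?thesis using a by (simp add: ord_power2)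
  qed
qed

text \<open>If \<open>1 + b\<^sup>2\<close> were a square modulo the maximal ideal for every \<open>b\<close>, all natural numbers,
  hence also \<open>-1\<close>, would be squares.\<close>

lemma nonsquare_unit_residue_norm:
  fixes \<epsilon> :: "'k::nonarch_local_field"
  assumes \<epsilon>: "nonsquare_unit \<epsilon>"
  obtains a b where "a \<in> ideal_pow 0" "b \<in> ideal_pow 0" "a\<^sup>2 - b\<^sup>2 * \<epsilon> - \<epsilon> \<in> ideal_pow 1"
proof (cases "\<exists>b\<in>ideal_pow 0. - 1 - b\<^sup>2 \<in> (ideal_pow 1 :: 'k set)")
  case True
  then obtain b :: 'k where b: "b \<in> ideal_pow 0" "- 1 - b\<^sup>2 \<in> ideal_pow 1" by blast
  have "\<epsilon> * (- 1 - b\<^sup>2) \<in> ideal_pow 1"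
    using b(2) unit_mult_ideal_pow_iff[OF nonsquare_unitD(1)[OF \<epsilon>]] by blast
  moreover have "\<epsilon> * (- 1 - b\<^sup>2) = 0\<^sup>2 - b\<^sup>2 * \<epsilon> - \<epsilon>" by (simp add: algebra_simps)
  ultimately show thesis using that[of 0 b] b(1) by simp
next
  case False
  let ?S = "\<lambda>x::'k. \<exists>b\<in>ideal_pow 0. x - b\<^sup>2 \<in> ideal_pow 1"
  \<comment> \<open>By pigeonhole some positive integer m vanishes in the residue field; then m - 1
    is congruent to -1, which in this case is not a square.\<close>
  obtain m where m: "0 < m" "(of_nat m :: 'k) \<in> ideal_pow 1"
  proof -
    obtain R :: "'k set" where R: "finite R" "\<And>x. x \<in> ideal_pow 0 \<Longrightarrow> \<exists>r\<in>R. x - r \<in> ideal_pow 1"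
      using residue_representatives[OF finite_residue_classes] by metis
    have "\<forall>n. \<exists>r. r \<in> R \<and> of_nat n - r \<in> ideal_pow 1"
      using R(2)[OF of_nat_in_ideal_pow] by blast
    then obtain f :: "nat \<Rightarrow> 'k" where f: "\<And>n. f n \<in> R \<and> of_nat n - f n \<in> ideal_pow 1"
      by metis
    have "\<not> inj f" using R(1) f finite_imageD[of f UNIV] finite_subset[of "range f" R] by auto
    then obtain i j where ij: "i < j" "f i = f j" by (metis injI linorder_neqE_nat)
    have "of_nat j - of_nat i \<in> (ideal_pow 1 :: 'k set)"
      using f[of i] f[of j] ij(2) ideal_pow_trans ideal_pow_diff_commute by metis
    then show thesis using that[of "j - i"] ij(1) by (simp add: of_nat_diff)
  qed
  have "\<not> ?S (of_nat (m - 1))"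
  proof
    assume "?S (of_nat (m - 1))"
    then obtain b :: 'k where b: "b \<in> ideal_pow 0" "of_nat (m - 1) - b\<^sup>2 \<in> ideal_pow 1" by blast
    have "(of_nat (m - 1) - b\<^sup>2) - of_nat m \<in> ideal_pow 1" using b(2) m(2) by (rule ideal_pow_diff)
    then have "- 1 - b\<^sup>2 \<in> ideal_pow 1" using m(1) by (simp add: of_nat_diff algebra_simps)
    then show False using False b(1) by blast
  qed
  moreover have "?S (of_nat n)" if step: "\<And>n. ?S (of_nat n) \<Longrightarrow> ?S (of_nat (Suc n))" for n
  proof (induction n)
    case 0
    show ?case by (intro bexI[of _ 0]) auto
  next
    case (Suc n)
    then show ?case by (rule step)
  qed
  ultimately obtain n where n: "?S (of_nat n)" "\<not> ?S (of_nat (Suc n))" by blast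
  then obtain b :: 'k where b: "b \<in> ideal_pow 0" "of_nat n - b\<^sup>2 \<in> ideal_pow 1" by blast
  have near: "of_nat (Suc n) - (1 + b\<^sup>2) \<in> ideal_pow 1" using b(2) by (simp add: algebra_simps)
  have "b * b \<in> ideal_pow 0" by (rule ideal_pow_mult[OF b(1) b(1)]) simp
  then have "1 + b\<^sup>2 \<in> ideal_pow 0"
    unfolding power2_eq_square by (intro ideal_pow_add) (auto simp: ideal_pow_def)
  moreover have "1 + b\<^sup>2 \<notin> ideal_pow 1"
    using False b(1) ideal_pow_minus_iff[of "1 + b\<^sup>2" 1] by auto
  ultimately have unit: "1 + b\<^sup>2 \<in> ord_sphere 0" by (simp add: ord_sphere_eq)
  obtain r where r: "r \<in> ord_sphere 0" "(1 + b\<^sup>2) - r\<^sup>2 \<in> ideal_pow 1 \<or> (1 + b\<^sup>2) - \<epsilon> * r\<^sup>2 \<in> ideal_pow 1"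
    using square_class_dichotomy[OF \<epsilon> unit] by blast
  have "(1 + b\<^sup>2) - r\<^sup>2 \<notin> ideal_pow 1"
    using n(2) near ideal_pow_trans r(1) sphere_zero_ideal by blast
  then have "(1 + b\<^sup>2) - \<epsilon> * r\<^sup>2 \<in> ideal_pow 1" using r(2) by blast
  \<comment> \<open>Multiplying 1 + b^2 = \<epsilon> r^2 modulo p by -\<epsilon> exhibits \<epsilon>
    as the norm of \<epsilon> r + b sqrt \<epsilon>.\<close>
  then have "- (\<epsilon> * ((1 + b\<^sup>2) - \<epsilon> * r\<^sup>2)) \<in> ideal_pow 1"
    unfolding ideal_pow_minus_iff using unit_mult_ideal_pow_iff[OF nonsquare_unitD(1)[OF \<epsilon>]] by blast
  moreover have "- (\<epsilon> * ((1 + b\<^sup>2) - \<epsilon> * r\<^sup>2)) = (\<epsilon> * r)\<^sup>2 - b\<^sup>2 * \<epsilon> - \<epsilon>"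
    by (simp add: power2_eq_square algebra_simps)
  moreover have "\<epsilon> * r \<in> ideal_pow 0"
    using nonsquare_unitD(1)[OF \<epsilon>] r(1) sphere_zero_mult sphere_zero_ideal by blast
  ultimately show thesis using that[of "\<epsilon> * r" b] b(1) by simp
qed

text \<open>Modulo p the unit is r^2 or \<epsilon> r^2, and \<epsilon> itself is a norm modulo p.
  The remaining factor in 1 + p is a square (1 + v)^2, hence the norm of a scalar.\<close>

lemma unit_is_unramified_norm:
  fixes \<epsilon> w :: "'k::nonarch_local_field"
  assumes two: "(2::'k) \<notin> max_ideal" and \<epsilon>: "nonsquare_unit \<epsilon>" and w: "w \<in> ord_sphere 0"
  obtains a b where "w = a\<^sup>2 - b\<^sup>2 * \<epsilon>"
proof -
  have "\<exists>a b. w - (a\<^sup>2 - b\<^sup>2 * \<epsilon>) \<in> ideal_pow 1"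
  proof -
    obtain r where r: "r \<in> ord_sphere 0" "w - r\<^sup>2 \<in> ideal_pow 1 \<or> w - \<epsilon> * r\<^sup>2 \<in> ideal_pow 1"
      using square_class_dichotomy[OF \<epsilon> w] by blast
    show ?thesis
    proof (cases "w - r\<^sup>2 \<in> ideal_pow 1")
      case True
      then show ?thesis by (intro exI[of _ r] exI[of _ 0]) simp
    next
      case False
      then have w': "w - \<epsilon> * r\<^sup>2 \<in> ideal_pow 1" using r(2) by blast
      obtain a b where ab: "a\<^sup>2 - b\<^sup>2 * \<epsilon> - \<epsilon> \<in> ideal_pow 1"
        using nonsquare_unit_residue_norm[OF \<epsilon>] by blast
      then have "r\<^sup>2 * (a\<^sup>2 - b\<^sup>2 * \<epsilon> - \<epsilon>) \<in> ideal_pow 1"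
        using unit_mult_ideal_pow_iff[OF sphere_zero_power2[OF r(1)]] by blast
      with w' have "w - \<epsilon> * r\<^sup>2 - r\<^sup>2 * (a\<^sup>2 - b\<^sup>2 * \<epsilon> - \<epsilon>) \<in> ideal_pow 1" by (rule ideal_pow_diff)
      moreover have "w - \<epsilon> * r\<^sup>2 - r\<^sup>2 * (a\<^sup>2 - b\<^sup>2 * \<epsilon> - \<epsilon>) = w - ((r * a)\<^sup>2 - (r * b)\<^sup>2 * \<epsilon>)"
        by (simp add: power_mult_distrib algebra_simps)
      ultimately show ?thesis by metis
    qed
  qed
  then obtain a b where ab: "w - (a\<^sup>2 - b\<^sup>2 * \<epsilon>) \<in> ideal_pow 1" by blast
  define z where "z = a\<^sup>2 - b\<^sup>2 * \<epsilon>"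
  have w': "w \<noteq> 0" "ord w = 0" using w by (auto simp: ord_sphere_def)
  have z: "z \<noteq> 0" "ord z = 0"
    using ord_cong[of w z] w' ab ideal_pow_diff_commute[of w z] by (auto simp: z_def)
  have "(w - z) * inverse z \<in> ideal_pow 1"
    by (rule ideal_pow_mult[OF ab[folded z_def], of _ 0]) (use z in \<open>auto simp: ideal_pow_def ord_inverse\<close>)
  then obtain v where v: "1 + (w - z) * inverse z = (1 + v)\<^sup>2"
    using one_add_max_ideal_square[OF two] by blast
  have "w = z * (1 + (w - z) * inverse z)" using z by (simp add: field_simps)
  also have "\<dots> = z * (1 + v)\<^sup>2" unfolding v ..
  also have "\<dots> = (a * (1 + v))\<^sup>2 - (b * (1 + v))\<^sup>2 * \<epsilon>"
    by (simp add: z_def power_mult_distrib left_diff_distrib)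
  finally show thesis using that by blast
qed

lemma quad_norm_image_unramified:
  fixes \<epsilon> x :: "'k::nonarch_local_field"
  assumes two: "(2::'k) \<notin> max_ideal" and \<epsilon>: "nonsquare_unit \<epsilon>" and x: "x \<noteq> 0"
  shows "x \<in> quad_norm \<epsilon> ` quad_units \<epsilon> \<longleftrightarrow> even (ord x)"
proof
  assume "x \<in> quad_norm \<epsilon> ` quad_units \<epsilon>"
  then show "even (ord x)" using even_ord_unramified_norm[OF \<epsilon>] by (auto simp: quad_norm_image_iff)
next
  assume "even (ord x)"
  then obtain m where m: "ord x = 2 * m" by blast
  obtain p :: 'k where p: "p \<noteq> 0" "ord p = m" using ord_surj by blast
  have "x / p\<^sup>2 \<in> ord_sphere 0" using x p m by (simp add: ord_sphere_def ord_divide ord_power2)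
  then obtain a b where "x / p\<^sup>2 = a\<^sup>2 - b\<^sup>2 * \<epsilon>" using unit_is_unramified_norm[OF two \<epsilon>] by blast
  then have "x = (a\<^sup>2 - b\<^sup>2 * \<epsilon>) * p\<^sup>2" using p(1) by (simp add: divide_eq_eq)
  then have "x = (p * a)\<^sup>2 - (p * b)\<^sup>2 * \<epsilon>"
    by (simp add: power_mult_distrib algebra_simps)
  then show "x \<in> quad_norm \<epsilon> ` quad_units \<epsilon>" using x by (auto simp: quad_norm_image_iff)
qed

text \<open>In the split case every non-zero element is a norm, in the unramified case exactly those
  of even order. Either way the indicator in the transform is constant on shells.\<close>

lemma quad_norm_image_ord:
  fixes \<epsilon> x y :: "'k::nonarch_local_field"
  assumes two: "(2::'k) \<notin> max_ideal" and \<epsilon>: "nonsquare_unit \<epsilon>" and \<theta>: "\<theta> \<in> {1, \<epsilon>}"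
    and "x \<noteq> 0" "y \<noteq> 0" "ord x = ord y"
  shows "x \<in> quad_norm \<theta> ` quad_units \<theta> \<longleftrightarrow> y \<in> quad_norm \<theta> ` quad_units \<theta>"
proof (cases "\<theta> = 1")
  case True
  then show ?thesis
    using assms norm_split[OF ord_two(1)[OF two]] unfolding quad_norm_image_iff by metis
next
  case False
  then show ?thesis using assms quad_norm_image_unramified[OF two \<epsilon>] by auto
qed

section \<open>Conjugacy of tori and depth\<close>

lemma mat2_mult:
  fixes a b c d :: "'k::field"
  shows "mat2 a b c d ** mat2 a' b' c' d' =
    mat2 (a * a' + b * c') (a * b' + b * d') (c * a' + d * c') (c * b' + d * d')"
  by (simp add: mat2_def matrix_matrix_mult_def vec_eq_iff forall_2 sum_2)

lemma mat2_one: "mat2 1 0 0 1 = (mat 1 :: 'k::field ^ 2 ^ 2)"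
  by (simp add: mat2_def mat_def vec_eq_iff forall_2)

lemma matrix_inv_mat2:
  fixes a b c d :: "'k::field"
  assumes "a * d - b * c = 1"
  shows "matrix_inv (mat2 a b c d) = mat2 d (- b) (- c) a"
proof -
  have "mat2 a b c d ** mat2 d (- b) (- c) a = mat 1" "mat2 d (- b) (- c) a ** mat2 a b c d = mat 1"
    using assms by (simp_all add: mat2_mult mult.commute flip: mat2_one)
  \<comment> \<open>\<open>matrix_inv\<close> chooses some two-sided inverse; the adjugate shows
    that one exists, and inverses are unique.\<close>
  moreover from this have "matrix_inv (mat2 a b c d) ** mat2 a b c d = mat 1"
    unfolding matrix_inv_def by (rule someI2[where P = "\<lambda>B. mat2 a b c d ** B = mat 1 \<and> B ** mat2 a b c d = mat 1", OF conjI]) simp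
  ultimately show ?thesis
    by (metis matrix_mul_assoc matrix_mul_lid matrix_mul_rid)
qed

text \<open>The matrix of p + r sqrt \<theta> commutes with the torus and has determinant w.
  Multiplication on the left by diag(1, 1/w) makes the determinant 1 and conjugates
  \<open>torus \<theta>\<close> to the torus of \<theta> / w^2. So the norm condition is what brings
  the conjugation into SL2.\<close>

lemma torus_conjugate:
  fixes \<theta> w :: "'k::field"
  assumes w: "w \<noteq> 0" "w = p\<^sup>2 - r\<^sup>2 * \<theta>" and \<theta>': "\<theta>' * w\<^sup>2 = \<theta>"
  shows "SL2_conjugate (torus \<theta>) (torus \<theta>')"
proof -
  define c where "c = inverse w"
  have c: "c * w = 1" "\<theta>' = c\<^sup>2 * \<theta>" using w(1) \<theta>' by (auto simp: c_def field_simps)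
  define g where "g = mat2 p r (c * r * \<theta>) (c * p)"
  have det: "p * (c * p) - r * (c * r * \<theta>) = 1"
    using c(1) unfolding w(2) by (simp add: power2_eq_square algebra_simps)
  have "det g = 1" using det by (simp add: g_def mat2_def det_2)
  have inv: "matrix_inv g = mat2 (c * p) (- r) (- (c * r * \<theta>)) p"
    unfolding g_def by (rule matrix_inv_mat2[OF det])
  have conj: "g ** mat2 a b (b * \<theta>) a ** matrix_inv g = mat2 a (b * w) (b * w * \<theta>') a" for a b
  proof -
    have e1: "(p * a + r * (b * \<theta>)) * (c * p) + (p * b + r * a) * (- (c * r * \<theta>)) = a * (c * w)"
      unfolding w(2) by (simp add: power2_eq_square algebra_simps)
    have e2: "(p * a + r * (b * \<theta>)) * (- r) + (p * b + r * a) * p = b * w"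
      unfolding w(2) by (simp add: power2_eq_square algebra_simps)
    have e3: "(c * r * \<theta> * a + c * p * (b * \<theta>)) * (c * p) + (c * r * \<theta> * b + c * p * a) * (- (c * r * \<theta>))
        = b * w * \<theta>'"
      unfolding w(2) c(2) by (simp add: power2_eq_square algebra_simps)
    have e4: "(c * r * \<theta> * a + c * p * (b * \<theta>)) * (- r) + (c * r * \<theta> * b + c * p * a) * p = a * (c * w)"
      unfolding w(2) by (simp add: power2_eq_square algebra_simps)
    show ?thesis unfolding inv unfolding g_def mat2_mult e1 e2 e3 e4 c(1) by simp
  qed
  have "(\<lambda>t. g ** t ** matrix_inv g) ` torus \<theta> = torus \<theta>'"
  proof
    show "(\<lambda>t. g ** t ** matrix_inv g) ` torus \<theta> \<subseteq> torus \<theta>'"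
    proof clarify
      fix t assume "t \<in> torus \<theta>"
      then obtain a b where t: "t = mat2 a b (b * \<theta>) a" "a\<^sup>2 - b\<^sup>2 * \<theta> = 1" by (auto simp: torus_def)
      have eq: "(b * w)\<^sup>2 * \<theta>' = b\<^sup>2 * \<theta>" using \<theta>' by (simp add: power_mult_distrib mult.commute mult.left_commute)
      show "g ** t ** matrix_inv g \<in> torus \<theta>'"
        unfolding t(1) conj torus_def by (intro CollectI exI conjI, rule refl) (simp only: eq t(2))
    qed
    show "torus \<theta>' \<subseteq> (\<lambda>t. g ** t ** matrix_inv g) ` torus \<theta>"
    proof
      fix t assume "t \<in> torus \<theta>'"
      then obtain a b where t: "t = mat2 a b (b * \<theta>') a" "a\<^sup>2 - b\<^sup>2 * \<theta>' = 1" by (auto simp: torus_def)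
      have eq: "(b * c)\<^sup>2 * \<theta> = b\<^sup>2 * \<theta>'" unfolding c(2) by (simp add: power_mult_distrib)
      have "mat2 a (b * c) (b * c * \<theta>) a \<in> torus \<theta>"
        unfolding torus_def by (intro CollectI exI conjI, rule refl) (simp only: eq t(2))
      moreover have "g ** mat2 a (b * c) (b * c * \<theta>) a ** matrix_inv g = t"
        unfolding conj t(1) using c(1) by (simp add: mult.assoc)
      ultimately show "t \<in> (\<lambda>t. g ** t ** matrix_inv g) ` torus \<theta>" by blast
    qed
  qed
  then show ?thesis using \<open>det g = 1\<close> unfolding SL2_conjugate_def SL2_def by blast
qed

section \<open>Depth in terms of valuations\<close>

lemma lie_functional_lie_elt: "lie_functional \<theta> \<beta> (lie_elt \<theta> c) = 2 * \<beta> * \<theta> * c"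
  by (simp add: lie_functional_def lie_elt_def mat2_mult) (simp add: mat2_def trace_def sum_2)

text \<open>Since 2 and \<theta> are units, the pairing 2 \<beta> \<theta> c has order ord \<beta> +
  ord c. The strict inequality in the definition of depth matches triviality from order d + 1 on, so
  the bound is attained.\<close>

lemma dual_depth_eq:
  fixes \<Phi> :: "'k::nonarch_local_field \<Rightarrow> complex"
  assumes two: "(2::'k) \<notin> max_ideal" and \<Phi>: "additive_char \<Phi>" "conductor_exponent \<Phi> d"
    and \<theta>: "\<theta> \<in> ord_sphere 0" and "\<beta> \<noteq> 0"
  shows "dual_depth \<Phi> \<theta> (lie_functional \<theta> \<beta>) = real_of_int (ord \<beta> - d)"
  unfolding dual_depth_def
proof (rule Greatest_equality)
  have \<theta>': "\<theta> \<noteq> 0" "ord \<theta> = 0" using \<theta> by (auto simp: ord_sphere_def)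
  note two' = ord_two[OF two]
  have depth: "lie_depth \<theta> c = ereal (real_of_int (ord c))" if "c \<noteq> 0" for c
    using that \<theta>' by (simp add: lie_depth_def ord_mult ord_power2)
  show "\<forall>c. ereal (- real_of_int (ord \<beta> - d)) < lie_depth \<theta> c \<longrightarrow> \<Phi> (lie_functional \<theta> \<beta> (lie_elt \<theta> c)) = 1"
  proof (intro allI impI)
    fix c assume c: "ereal (- real_of_int (ord \<beta> - d)) < lie_depth \<theta> c"
    show "\<Phi> (lie_functional \<theta> \<beta> (lie_elt \<theta> c)) = 1"
    proof (cases "c = 0")
      case True
      then show ?thesis by (simp add: lie_functional_lie_elt additive_char_zero[OF \<Phi>(1)])
    next
      case False
      have "d < ord \<beta> + ord c" using c depth[OF False] by simp
      then have "2 * \<beta> * \<theta> * c \<in> ideal_pow (d + 1)"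
        using False \<theta>' two' \<open>\<beta> \<noteq> 0\<close> by (intro in_ideal_pow_ord) (simp add: ord_mult)
      then show ?thesis using \<Phi>(2) by (simp add: lie_functional_lie_elt conductor_exponent_def)
    qed
  qed
  fix \<rho> :: real
  assume \<rho>: "\<forall>c. ereal (- \<rho>) < lie_depth \<theta> c \<longrightarrow> \<Phi> (lie_functional \<theta> \<beta> (lie_elt \<theta> c)) = 1"
  obtain y where y: "y \<noteq> 0" "ord y = d" "\<Phi> y \<noteq> 1" using conductor_exponent_witness[OF \<Phi>] by blast
  \<comment> \<open>Solved from 2 \<beta> \<theta> c = y: an element of depth d - ord \<beta> on
    which the character is non-trivial.\<close>
  define c where "c = y / (2 * \<beta> * \<theta>)"
  have c: "c \<noteq> 0" "ord c = d - ord \<beta>" "2 * \<beta> * \<theta> * c = y"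
    using y two' \<theta>' \<open>\<beta> \<noteq> 0\<close> by (auto simp: c_def ord_divide ord_mult)
  have "\<not> ereal (- \<rho>) < lie_depth \<theta> c" using \<rho> y(3) c(3) by (metis lie_functional_lie_elt)
  then show "\<rho> \<le> real_of_int (ord \<beta> - d)" using depth[OF c(1)] c(2) by simp
qed

section \<open>Shells of the mock Fourier transform\<close>

definition phase :: "'k::field \<Rightarrow> 'k \<Rightarrow> 'k \<Rightarrow> 'k" where
  "phase \<theta> \<theta>' x = x * \<theta>' + inverse x * \<theta>"

text \<open>The derivative \<open>x d/dx\<close> of the phase, as the shells are rescaled multiplicatively.\<close>

definition phase_deriv :: "'k::field \<Rightarrow> 'k \<Rightarrow> 'k \<Rightarrow> 'k" where
  "phase_deriv \<theta> \<theta>' x = x * \<theta>' - inverse x * \<theta>"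

text \<open>Taylor expansion with exact remainder, from 1 / (1 + u) = 1 - u + u^2 / (1 + u).\<close>

lemma phase_scale:
  fixes x u :: "'k::field"
  assumes "x \<noteq> 0" "1 + u \<noteq> 0"
  shows "phase \<theta> \<theta>' (x * (1 + u)) - phase \<theta> \<theta>' x =
    u * phase_deriv \<theta> \<theta>' x + inverse x * \<theta> * (u\<^sup>2 * inverse (1 + u))"
proof -
  have "inverse (1 + u) = 1 - u + u\<^sup>2 * inverse (1 + u)"
  proof -
    have "(1 - u + u\<^sup>2 * inverse (1 + u)) * (1 + u) = (1 - u) * (1 + u) + u\<^sup>2 * (inverse (1 + u) * (1 + u))"
      by (simp add: algebra_simps)
    also have "\<dots> = (1 - u) * (1 + u) + u\<^sup>2" using assms(2) by simp
    also have "\<dots> = 1" by (simp add: power2_eq_square algebra_simps)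
    finally show ?thesis by (simp add: inverse_unique mult.commute)
  qed
  then have "inverse (x * (1 + u)) = inverse x * (1 - u + u\<^sup>2 * inverse (1 + u))"
    by (simp add: inverse_mult_distrib)
  then show ?thesis unfolding phase_def phase_deriv_def by (simp only:) (simp add: algebra_simps)
qed

text \<open>The shell carries no critical point of the phase, which varies there faster than the
  character can resolve.\<close>

lemma noncritical_shell_vanishes:
  fixes \<psi> :: "'k::nonarch_local_field \<Rightarrow> complex"
  assumes \<mu>: "normalized_haar \<mu>" and \<psi>: "additive_char \<psi>" "conductor_exponent \<psi> d"
    and \<theta>: "\<theta> \<in> ord_sphere 0" and \<theta>': "\<theta>' \<noteq> 0"
    and a: "a < d" "a \<le> n + ord \<theta>'" "a \<le> - n"
    and deriv: "\<And>x. x \<in> ord_sphere n \<Longrightarrow> phase_deriv \<theta> \<theta>' x \<in> ord_sphere a"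
    and g: "\<And>x u. x \<in> ord_sphere n \<Longrightarrow> u \<in> ideal_pow 1 \<Longrightarrow> g (x * (1 + u)) = g x"
  shows "(LINT x:ord_sphere n|\<mu>. \<psi> (phase \<theta> \<theta>' x) * g x) = 0"
proof -
  obtain y where y: "y \<noteq> 0" "ord y = d" "\<psi> y \<noteq> 1" using conductor_exponent_witness[OF \<psi>] by blast
  have \<theta>0: "\<theta> \<noteq> 0" "ord \<theta> = 0" using \<theta> by (auto simp: ord_sphere_def)
  let ?D = "phase_deriv \<theta> \<theta>'"
  show ?thesis
  proof (rule shell_integral_local_scaling[OF \<mu> y(3)])
    fix x0 :: 'k assume x0: "x0 \<in> ord_sphere n"
    have D0: "?D x0 \<noteq> 0" "ord (?D x0) = a" using deriv[OF x0] by (auto simp: ord_sphere_def)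
    have x0': "x0 \<noteq> 0" "ord x0 = n" using x0 by (auto simp: ord_sphere_def)
    \<comment> \<open>The linear change u D(x0) of the phase becomes y, of order d with \<psi>(y)
      \<noteq> 1; a < d puts u into p.\<close>
    define u where "u = y / ?D x0"
    have u: "u \<in> ideal_pow (d - a)" using y D0 by (simp add: u_def ideal_pow_def ord_divide)
    have u1: "u \<in> ideal_pow 1" by (rule ideal_pow_mono[OF _ u]) (use a(1) in simp)
    note w = one_add_max_ideal[OF u1]
    have "\<psi> (phase \<theta> \<theta>' (x * (1 + u))) * g (x * (1 + u)) = \<psi> y * (\<psi> (phase \<theta> \<theta>' x) * g x)"
      if x: "x - x0 \<in> ideal_pow (n + 1)" for x
    proof -
      have x': "x \<noteq> 0" "ord x = n" using ord_cong[of x0 x] x0' x by auto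
      \<comment> \<open>On the coset of x0 the derivative is constant modulo p^(a+1), so one u, of
        order d - a, serves the whole coset modulo p^(d+1).\<close>
      have "(x - x0) * \<theta>' \<in> ideal_pow (a + 1)"
        by (rule ideal_pow_mult[OF x, of _ "ord \<theta>'"]) (use a in \<open>auto simp: ideal_pow_def\<close>)
      moreover have "(x - x0) * (inverse x * inverse x0 * \<theta>) \<in> ideal_pow (a + 1)"
        by (rule ideal_pow_mult[OF x, of _ "- 2 * n"])
          (use a x' x0' \<theta>0 in \<open>auto simp: ideal_pow_def ord_mult ord_inverse\<close>)
      ultimately have "(x - x0) * \<theta>' + (x - x0) * (inverse x * inverse x0 * \<theta>) \<in> ideal_pow (a + 1)"
        by (rule ideal_pow_add)
      moreover have "?D x - ?D x0 = (x - x0) * \<theta>' + (inverse x0 - inverse x) * \<theta>"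
        by (simp add: phase_deriv_def algebra_simps)
      moreover have "inverse x0 - inverse x = (x - x0) * (inverse x * inverse x0)"
        using x'(1) x0'(1) by (simp add: field_simps)
      ultimately have "?D x - ?D x0 \<in> ideal_pow (a + 1)" by (simp only: mult.assoc)
      then have "u * (?D x - ?D x0) \<in> ideal_pow (d + 1)" by (rule ideal_pow_mult[OF u]) simp
      moreover have "u * ?D x0 = y" using D0 by (simp add: u_def)
      ultimately have lin: "u * ?D x - y \<in> ideal_pow (d + 1)" by (simp add: right_diff_distrib)
      \<comment> \<open>The order is at least -n + 2 (d - a) \<ge> 2 d - a \<ge> d + 1, from a \<le>
        -n and a < d.\<close>
      have quad: "inverse x * \<theta> * (u\<^sup>2 * inverse (1 + u)) \<in> ideal_pow (d + 1)"
      proof (cases "u = 0")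
        case False
        have "d - a \<le> ord u" using u False by (simp add: ideal_pow_def)
        then have "d + 1 \<le> - n + 2 * ord u" using a by simp
        then show ?thesis using False x' \<theta>0 w
          by (intro in_ideal_pow_ord) (simp add: ord_mult ord_inverse ord_power2)
      qed simp
      have eq: "phase \<theta> \<theta>' (x * (1 + u)) - (y + phase \<theta> \<theta>' x) =
          (u * ?D x - y) + inverse x * \<theta> * (u\<^sup>2 * inverse (1 + u))"
        using phase_scale[OF x'(1) w(1), of \<theta> \<theta>'] by (simp add: algebra_simps)
      have "\<psi> (phase \<theta> \<theta>' (x * (1 + u)) - (y + phase \<theta> \<theta>' x)) = 1"
        unfolding eq using \<psi>(2) ideal_pow_add[OF lin quad] unfolding conductor_exponent_def by blast
      then have "\<psi> (phase \<theta> \<theta>' (x * (1 + u))) = \<psi> (y + phase \<theta> \<theta>' x)"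
        by (rule additive_char_cong[OF \<psi>(1)])
      then show ?thesis
        using g[OF ord_sphereI[OF x'] u1] additive_char_add[OF \<psi>(1)] by simp
    qed
    then show "\<exists>u\<in>ideal_pow 1. \<forall>x. x - x0 \<in> ideal_pow (n + 1) \<longrightarrow>
        \<psi> (phase \<theta> \<theta>' (x * (1 + u))) * g (x * (1 + u)) = \<psi> y * (\<psi> (phase \<theta> \<theta>' x) * g x)"
      using u1 by blast
  qed
qed

lemma phase_deriv_ord_distinct:
  fixes x :: "'k::discretely_valued_field"
  assumes \<theta>: "\<theta> \<in> ord_sphere 0" and \<theta>': "\<theta>' \<noteq> 0" and x: "x \<in> ord_sphere n" and "n + ord \<theta>' \<noteq> - n"
  shows "phase_deriv \<theta> \<theta>' x \<in> ord_sphere (min (n + ord \<theta>') (- n))"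
proof -
  have x': "x \<noteq> 0" "ord x = n" and \<theta>0: "\<theta> \<noteq> 0" "ord \<theta> = 0"
    using x \<theta> by (auto simp: ord_sphere_def)
  have A: "x * \<theta>' \<noteq> 0" "ord (x * \<theta>') = n + ord \<theta>'" using x' \<theta>' by (auto simp: ord_mult)
  have B: "- (inverse x * \<theta>) \<noteq> 0" "ord (- (inverse x * \<theta>)) = - n"
    using x' \<theta>0 by (auto simp: ord_mult ord_inverse)
  have eq: "phase_deriv \<theta> \<theta>' x = x * \<theta>' + - (inverse x * \<theta>)" by (simp add: phase_deriv_def)
  show ?thesis
  proof (cases "n + ord \<theta>' < - n")
    case True
    then have "- (inverse x * \<theta>) \<in> ideal_pow (ord (x * \<theta>') + 1)"
      unfolding A(2) by (intro in_ideal_pow_ord) (use B in simp)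
    from ord_add_dominant[OF A(1) this] show ?thesis
      unfolding eq using True A by (intro ord_sphereI) auto
  next
    case False
    then have "x * \<theta>' \<in> ideal_pow (ord (- (inverse x * \<theta>)) + 1)"
      unfolding B(2) using assms(4) by (intro in_ideal_pow_ord) (use A in simp)
    from ord_add_dominant[OF B(1) this] show ?thesis
      unfolding eq using False B by (intro ord_sphereI) (auto simp: add.commute)
  qed
qed

text \<open>The derivative is -(\<theta>' / x) (\<theta> / \<theta>' - x^2). Cancellation beyond
  order 2 n in the second factor would make \<theta> / \<theta>' a square.\<close>

lemma phase_deriv_ord_nonsquare:
  fixes x :: "'k::nonarch_local_field"
  assumes two: "(2::'k) \<notin> max_ideal" and \<theta>: "\<theta> \<in> ord_sphere 0" and \<theta>': "\<theta>' \<noteq> 0"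
    and x: "x \<in> ord_sphere n" and n: "n + ord \<theta>' = - n" and nsq: "\<And>w. \<theta>' * w\<^sup>2 \<noteq> \<theta>"
  shows "phase_deriv \<theta> \<theta>' x \<in> ord_sphere (- n)"
proof -
  have x': "x \<noteq> 0" "ord x = n" and \<theta>0: "\<theta> \<noteq> 0" "ord \<theta> = 0"
    using x \<theta> by (auto simp: ord_sphere_def)
  let ?z = "\<theta> / \<theta>' - x\<^sup>2"
  have "?z \<notin> ideal_pow (2 * ord x + 1)"
  proof
    assume "?z \<in> ideal_pow (2 * ord x + 1)"
    from near_square_is_square[OF two x'(1) this] obtain w where "\<theta> / \<theta>' = w\<^sup>2" by blast
    then show False using nsq[of w] \<theta>' by (simp add: field_simps)
  qed
  moreover have "?z \<in> ideal_pow (2 * ord x)"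
    by (rule ideal_pow_diff; rule in_ideal_pow_ord)
      (use x' \<theta>0 \<theta>' n in \<open>auto simp: ord_divide ord_power2\<close>)
  ultimately have z: "?z \<noteq> 0" "ord ?z = 2 * n" using x'(2) by (auto simp: ideal_pow_def)
  have "phase_deriv \<theta> \<theta>' x = - (inverse x * \<theta>' * ?z)"
    using x' \<theta>' by (simp add: phase_deriv_def power2_eq_square field_simps)
  then show ?thesis
    using z x' \<theta>' n by (intro ord_sphereI) (auto simp: ord_mult ord_inverse)
qed

text \<open>At the critical level the integral is a Salie sum. The substitution
  \<open>x \<mapsto> \<theta> / (\<theta>' x)\<close> fixes the phase and, \<open>\<theta> / \<theta>'\<close> being a non-square, changes
  the sign of the Gauss integral.\<close>

lemma critical_shell_vanishes:
  fixes \<psi> :: "'k::nonarch_local_field \<Rightarrow> complex"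
  assumes two: "(2::'k) \<notin> max_ideal" and \<mu>: "normalized_haar \<mu>"
    and \<psi>: "additive_char \<psi>" "conductor_exponent \<psi> (- n)"
    and \<theta>: "\<theta> \<in> ord_sphere 0" and \<theta>': "\<theta>' \<noteq> 0"
    and n: "n + ord \<theta>' = - n" and nsq: "\<And>w. \<theta>' * w\<^sup>2 \<noteq> \<theta>"
    and i: "\<And>x y. x \<in> ord_sphere n \<Longrightarrow> y \<in> ord_sphere n \<Longrightarrow> i x = i y"
  shows "(LINT x:ord_sphere n|\<mu>. \<psi> (phase \<theta> \<theta>' x) *
    (i x * gauss_integral \<mu> (\<lambda>y. \<psi> (- inverse x * y)))) = 0"
proof (rule shell_integral_eigenfunction[OF \<mu>, where \<tau> = "\<lambda>x. \<theta> / (\<theta>' * x)" and \<zeta> = "- 1"])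
  let ?\<tau> = "\<lambda>x. \<theta> / (\<theta>' * x)"
  have \<theta>0: "\<theta> \<noteq> 0" "ord \<theta> = 0" using \<theta> by (auto simp: ord_sphere_def)
  have \<tau>S: "?\<tau> x \<in> ord_sphere n" if "x \<in> ord_sphere n" for x
    using that \<theta>0 \<theta>' n by (auto simp: ord_sphere_def ord_divide ord_mult)
  have \<tau>\<tau>: "?\<tau> (?\<tau> x) = x" if "x \<noteq> 0" for x using that \<theta>0 \<theta>' by simp
  show "bij_betw ?\<tau> (ord_sphere n) (ord_sphere n)"
  proof (rule bij_betw_byWitness[where f' = ?\<tau>])
    show "\<forall>x\<in>ord_sphere n. ?\<tau> (?\<tau> x) = x" "\<forall>x\<in>ord_sphere n. ?\<tau> (?\<tau> x) = x"
      using \<tau>\<tau>[OF ord_sphereD(1)] by blast+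
    show "?\<tau> ` ord_sphere n \<subseteq> ord_sphere n" "?\<tau> ` ord_sphere n \<subseteq> ord_sphere n"
      using \<tau>S by blast+
  qed
  show "dist (?\<tau> x) (?\<tau> y) = dist x y" if "x \<in> ord_sphere n" "y \<in> ord_sphere n" for x y
  proof (rule dist_eqI)
    have x: "x \<noteq> 0" "ord x = n" and y: "y \<noteq> 0" "ord y = n" using that by (auto simp: ord_sphere_def)
    show "?\<tau> x = ?\<tau> y \<longleftrightarrow> x = y" using x y \<theta>0 \<theta>' by (auto simp: field_simps)
    assume "x \<noteq> y"
    \<comment> \<open>The denominator has order ord \<theta>' + 2 n = 0 and \<theta> is a unit, so
      the order of the difference is preserved.\<close>
    moreover have "?\<tau> x - ?\<tau> y = \<theta> * (y - x) / (\<theta>' * x * y)"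
      using x y \<theta>' by (simp add: field_simps)
    ultimately show "ord (?\<tau> x - ?\<tau> y) = ord (x - y)"
      using x y \<theta>0 \<theta>' n ord_diff_commute[of x y] by (simp add: ord_divide ord_mult)
  qed
  fix x :: 'k assume xS: "x \<in> ord_sphere n"
  then have x: "x \<noteq> 0" "ord x = n" by (auto simp: ord_sphere_def)
  \<comment> \<open>This is the factor that the substitution introduces into 1 / x. It is a unit
    because ord \<theta>' = -2 n, and a square root modulo p would lift to a square root of \<theta>
    / \<theta>'.\<close>
  define u where "u = \<theta>' * x\<^sup>2 / \<theta>"
  have u: "u \<noteq> 0" "ord u = 0" using x \<theta>0 \<theta>' n by (auto simp: u_def ord_divide ord_mult ord_power2)
  have "u - y\<^sup>2 \<notin> ideal_pow 1" if y: "y \<in> ideal_pow 0" for y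
  proof
    assume uy: "u - y\<^sup>2 \<in> ideal_pow 1"
    have y2: "y\<^sup>2 \<noteq> 0 \<and> ord (y\<^sup>2) = 0"
      using ord_cong[of u "y\<^sup>2"] u uy ideal_pow_diff_commute[of u "y\<^sup>2"] by auto
    then have "y \<noteq> 0" "ord y = 0" using ord_power2[of y] by auto
    then obtain w where w: "w \<noteq> 0" "u = w\<^sup>2"
      using near_square_is_square[OF two, of y u] uy by auto
    then have "\<theta>' * (x / w)\<^sup>2 = \<theta>" using \<theta>0 by (simp add: u_def power_divide field_simps)
    then show False using nsq by blast
  qed
  then have nu: "nonsquare_unit u" using u by (simp add: nonsquare_unit_def integer_ring_eq max_ideal_eq)
  have inv\<tau>: "inverse (?\<tau> x) = inverse x * u"
    using x by (simp add: u_def power2_eq_square field_simps)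
  \<comment> \<open>Here the level matters: \<psi> has exponent -n and 1 / x has order -n, so the
    rescaled character has exponent 0.\<close>
  have "conductor_exponent (\<lambda>y. \<psi> (- inverse x * y)) 0"
    using conductor_exponent_scale[OF \<psi>(2), of "- inverse x"] x by (simp add: ord_inverse)
  from gauss_integral_nonsquare[OF two \<mu> additive_char_scale[OF \<psi>(1)] this nu]
  have "gauss_integral \<mu> (\<lambda>y. \<psi> (- inverse (?\<tau> x) * y)) = - gauss_integral \<mu> (\<lambda>y. \<psi> (- inverse x * y))"
    unfolding inv\<tau> by (simp add: mult.assoc)
  moreover have "phase \<theta> \<theta>' (?\<tau> x) = phase \<theta> \<theta>' x"
    unfolding phase_def inv\<tau> using x \<theta>0 \<theta>' by (simp add: u_def power2_eq_square field_simps)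
  moreover have "i (?\<tau> x) = i x" using i \<tau>S xS by blast
  ultimately show "\<psi> (phase \<theta> \<theta>' (?\<tau> x)) *
      (i (?\<tau> x) * gauss_integral \<mu> (\<lambda>y. \<psi> (- inverse (?\<tau> x) * y))) =
      - 1 * (\<psi> (phase \<theta> \<theta>' x) * (i x * gauss_integral \<mu> (\<lambda>y. \<psi> (- inverse x * y))))"
    by simp
qed simp

text \<open>The factor 1 + u is a square of a unit and is absorbed by rescaling t.\<close>

lemma gauss_integral_scale_one_add:
  fixes \<psi> :: "'k::nonarch_local_field \<Rightarrow> complex"
  assumes two: "(2::'k) \<notin> max_ideal" and \<mu>: "normalized_haar \<mu>" and u: "u \<in> ideal_pow 1"
  shows "gauss_integral \<mu> (\<lambda>y. \<psi> (- inverse (x * (1 + u)) * y)) =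
    gauss_integral \<mu> (\<lambda>y. \<psi> (- inverse x * y))"
proof -
  obtain w where w: "w \<in> ideal_pow 1" "1 + u = (1 + w)\<^sup>2"
    using one_add_max_ideal_square[OF two u] by blast
  have "inverse (1 + w) \<in> ord_sphere 0"
    using one_add_max_ideal[OF w(1)] by (simp add: ord_sphere_def ord_inverse)
  from gauss_integral_square[OF \<mu> this, of "\<lambda>y. \<psi> (- inverse x * y)"]
  show ?thesis unfolding w(2) by (simp add: inverse_mult_distrib power_inverse mult.assoc)
qed

text \<open>The part of the exponent free of t leaves the inner sum as the phase, and the
  multiplicative measure contributes only q^n on each shell. Vanishing of the transform is thereby
  reduced to single shells.\<close>

lemma mock_fourier_eq:
  fixes \<Phi> :: "'k::nonarch_local_field \<Rightarrow> complex"
  assumes "additive_char \<Phi>" and \<mu>: "normalized_haar \<mu>"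
  shows "mock_fourier \<mu> \<Phi> \<theta> \<beta> \<theta>' s =
    (\<Sum>\<^sub>\<infinity>n\<in>(UNIV :: int set). real (card (residue_classes :: 'k set set)) powi n *\<^sub>R
      (LINT x:ord_sphere n|\<mu>. \<Phi> (\<beta> * s * phase \<theta> \<theta>' x) *
        (indicator (quad_norm \<theta> ` quad_units \<theta>) x *
          gauss_integral \<mu> (\<lambda>y. \<Phi> (\<beta> * s * (- inverse x * y))))))"
proof -
  have inner: "(\<Sum>\<^sub>\<infinity>l\<in>(UNIV :: int set). LINT t:ord_sphere l|\<mu>.
        \<Phi> (\<beta> * s * (x * \<theta>' + inverse x * \<theta> - inverse x * t\<^sup>2))) =
      \<Phi> (\<beta> * s * phase \<theta> \<theta>' x) * gauss_integral \<mu> (\<lambda>y. \<Phi> (\<beta> * s * (- inverse x * y)))" for x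
  proof -
    have "\<beta> * s * (x * \<theta>' + inverse x * \<theta> - inverse x * t\<^sup>2) =
        \<beta> * s * phase \<theta> \<theta>' x + \<beta> * s * (- inverse x * t\<^sup>2)" for t
      by (simp add: phase_def algebra_simps)
    then show ?thesis
      unfolding gauss_integral_def
      by (simp only: additive_char_add[OF assms(1)] set_integral_mult_right infsum_cmult_right')
  qed
  show ?thesis
    unfolding mock_fourier_def inner shell_integral_mult_haar[OF \<mu>]
    by (simp only: mult.left_commute)
qed

theorem theorem9p1:
  fixes \<Phi> :: "'k::nonarch_local_field \<Rightarrow> complex"
    and \<mu> :: "'k measure"
    and \<epsilon> \<theta> \<beta> \<theta>' s :: 'k
  assumes residual_char: "(2::'k) \<notin> max_ideal"
    and \<Phi>: "nontrivial_additive_character \<Phi>"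
    and \<mu>: "normalized_haar \<mu>"
    and \<epsilon>: "nonsquare_unit \<epsilon>"
    and \<theta>: "\<theta> \<in> {1, \<epsilon>}"
    and nonzero: "\<beta> \<noteq> 0" "s \<noteq> 0" "\<theta>' \<noteq> 0"
    and depth: "ereal (dual_depth \<Phi> \<theta> (lie_functional \<theta> \<beta>)) + lie_depth \<theta>' s \<le> 0"
    and not_conjugate: "\<not> SL2_conjugate (torus \<theta>) (torus \<theta>')"
  shows "mock_fourier \<mu> \<Phi> \<theta> \<beta> \<theta>' s = 0"
proof -
  note two = residual_char
  let ?N = "quad_norm \<theta> ` quad_units \<theta>"
  define \<psi> where "\<psi> y = \<Phi> (\<beta> * s * y)" for y
  let ?g = "\<lambda>x. indicator ?N x * gauss_integral \<mu> (\<lambda>y. \<psi> (- inverse x * y))"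
  have \<theta>S: "\<theta> \<in> ord_sphere 0"
    using \<theta> nonsquare_unitD(1)[OF \<epsilon>] by (auto simp: ord_sphere_def)
  have \<theta>0: "\<theta> \<noteq> 0" "ord \<theta> = 0" using \<theta>S by (auto simp: ord_sphere_def)
  have char: "additive_char \<Phi>" by (rule nontrivial_additive_characterD(1)[OF \<Phi>])
  obtain d0 where d0: "conductor_exponent \<Phi> d0" using conductor_exponent_exists[OF \<Phi>] by blast
  define d where "d = d0 - ord \<beta> - ord s"
  have \<psi>: "additive_char \<psi>" "conductor_exponent \<psi> d"
    using additive_char_scale[OF char, of "\<beta> * s"] conductor_exponent_scale[OF d0, of "\<beta> * s"] nonzero
    by (simp_all add: \<psi>_def[abs_def] d_def ord_mult algebra_simps)
  \<comment> \<open>The two depths are ord \<beta> - d0 and ord s + ord \<theta>' / 2; their sum is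
    ord \<theta>' / 2 - d.\<close>
  have "real_of_int (ord \<beta> - d0) + real_of_int (2 * ord s + ord \<theta>') / 2 \<le> 0"
    using depth nonzero
    by (simp add: dual_depth_eq[OF two char d0 \<theta>S nonzero(1)] lie_depth_def ord_mult ord_power2)
  then have "real_of_int (ord \<theta>') \<le> real_of_int (2 * d)" by (simp add: d_def field_simps)
  then have ord_le: "ord \<theta>' \<le> 2 * d" by linarith
  have ind: "indicator ?N x = (indicator ?N y :: complex)"
    if "x \<in> ord_sphere n" "y \<in> ord_sphere n" for x y n
    using quad_norm_image_ord[OF two \<epsilon> \<theta>, of x y] that by (simp add: ord_sphere_def indicator_def)
  have g_scale: "?g (x * (1 + u)) = ?g x" if "x \<in> ord_sphere n" "u \<in> ideal_pow 1" for x u n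
  proof -
    have "x * (1 + u) \<in> ord_sphere n"
      using ord_scale_one_add[OF that(2), of x] that(1) by (simp add: ord_sphere_def)
    then show ?thesis
      using ind[OF _ that(1)] gauss_integral_scale_one_add[OF two \<mu> that(2)] by simp
  qed
  have shell: "(LINT x:ord_sphere n|\<mu>. \<psi> (phase \<theta> \<theta>' x) * ?g x) = 0" for n
  proof (cases "n + ord \<theta>' = - n")
    case False
    show ?thesis
    proof (rule noncritical_shell_vanishes[OF \<mu> \<psi> \<theta>S nonzero(3) _ _ _ phase_deriv_ord_distinct[OF \<theta>S nonzero(3) _ False] g_scale])
      \<comment> \<open>Two distinct integers with sum ord \<theta>' \<le> 2 d: the smaller one is
        below d.\<close>
      show "min (n + ord \<theta>') (- n) < d" using ord_le False by linarith
    qed auto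
  next
    case n: True
    show ?thesis
    proof (cases "\<exists>w. \<theta>' * w\<^sup>2 = \<theta>")
      case True
      then obtain w where w: "\<theta>' * w\<^sup>2 = \<theta>" by blast
      then have w0: "w \<noteq> 0" using \<theta>0 by auto
      have "ord (\<theta>' * w\<^sup>2) = 0" using w \<theta>0 by simp
      then have "ord w = n" using w0 nonzero(3) n by (simp add: ord_mult ord_power2)
      moreover have "w \<notin> ?N"
        using torus_conjugate[OF w0 _ w] not_conjugate by (auto simp: quad_norm_image_iff)
      ultimately have "indicator ?N x = (0 :: complex)" if "x \<in> ord_sphere n" for x
        using ind[OF that, of w] w0 by (simp add: ord_sphere_def)
      then have "(LINT x:ord_sphere n|\<mu>. \<psi> (phase \<theta> \<theta>' x) * ?g x) = (LINT x:ord_sphere n|\<mu>. 0)"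
        by (intro shell_integral_cong[OF \<mu>]) simp
      then show ?thesis by simp
    next
      case nsq: False
      show ?thesis
      proof (cases "- n = d")
        case True
        then show ?thesis
          using critical_shell_vanishes[OF two \<mu> \<psi>(1) _ \<theta>S nonzero(3) n, of "indicator ?N"] nsq \<psi>(2) ind
          by blast
      next
        case False
        show ?thesis
        proof (rule noncritical_shell_vanishes[OF \<mu> \<psi> \<theta>S nonzero(3) _ _ _ _ g_scale])
          \<comment> \<open>On this shell -2 n = ord \<theta>' \<le> 2 d, and equality -n = d has
            been split off.\<close>
          show "- n < d" "- n \<le> n + ord \<theta>'" "- n \<le> - n" using n ord_le False by linarith+
          show "phase_deriv \<theta> \<theta>' x \<in> ord_sphere (- n)" if "x \<in> ord_sphere n" for x
            using phase_deriv_ord_nonsquare[OF two \<theta>S nonzero(3) that n] nsq by blast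
        qed
      qed
    qed
  qed
  show ?thesis
    unfolding mock_fourier_eq[OF char \<mu>] using shell[unfolded \<psi>_def] by simp
qed

end
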